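(* For every integer $n\ge 2$ let $Q_{n+1}^{R,l}$ and $Q_{n+1}^{R,r}$ be the $(n+1)$-point left and right Radau quadrature formulae associated with the spline space $S_{n,3}$, i.e. the formulae determined uniquely by the property $R[Q_{n+1}^{R,l};f]=R[Q_{n+1}^{R,r};f]=0$ for every $f\in S_{n,3}$ (see context). Then: (a) For every $n\ge 2$ the error constants of $Q_{n+1}^{R,l}$ and $Q_{n+1}^{R,r}$ are given by $$c_{3}\big(Q_{n+1}^{R,l}\big)=-c_{3}\big(Q_{n+1}^{R,r}\big)=\frac{\sqrt{3}}{216n^3}-\frac{\sqrt{3}}{108n^4}\sum_{k=0}^{n-1}\frac{1}{(2+\sqrt{3})^{2k+1}+1}.$$ Moreover, for each $*\in\{r,l\}$ and all $n\geq 4$, $$\frac{\sqrt{3}}{216n^3}-\frac{1}{269.13\,n^4}<\big|c_{3}\big(Q_{n+1}^{R,*}\big)\big|<\frac{\sqrt{3}}{216n^3}-\frac{1}{269.14\,n^4}.$$ (b) Let $f\in C^3[0,1]$. For each $*\in\{r,l\}$, $R[Q_{n+1}^{R,*};f]=o(n^{-3})$ as $n\to\infty$ if and only if $f''(0)=f''(1)$. Moreover, if $\operatorname{sign}\{f''(1)-f''(0)\}=\epsilon\neq 0$, then there exists $n_0\in\mathbb{N}$ such that $\epsilon\,R[Q_{n+1}^{R,r};f]\leq 0$ and $\epsilon\,R[Q_{n+1}^{R,l};f]\geq 0$ for all $n\geq n_0$. (c) If $f\in W_1^3[0,1]$ and $f'''\ge 0$ a.e. in $[0,1]$, then for all $n\geq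 2$, $$0\geq R\big[Q_{2n+1}^{R,r};f\big]\geq R\big[Q_{n+1}^{R,r};f\big]\quad\text{and}\quad 0\leq R\big[Q_{2n+1}^{R,l};f\big]\leq R\big[Q_{n+1}^{R,l};f\big].$$
   Context: Notation. $I[f]=\int_0^1 f(x)\,dx$. A quadrature formula is a linear functional $Q[f]=\sum_{i=1}^{m}a_i f(\tau_i)$ with real weights $a_i$ and nodes $0\le\tau_1<\dots<\tau_m\le 1$ (an $m$-point formula); its remainder is $R[Q;f]=I[f]-Q[f]$. Spline space. For $n\ge 2$ and $x_k=k/n$, $k=0,\dots,n$, $S_{n,3}$ is the linear space of all $f\in C[0,1]$ whose restriction to each $(x_k,x_{k+1})$, $k=0,\dots,n-1$, is a polynomial of degree at most $2$. Radau formulae. The right Radau formula $Q_{n+1}^{R,r}$ associated with $S_{n,3}$ is the unique $(n+1)$-point quadrature formula of the form $\sum_{k=0}^{n-1}a_{k,n}f(\tau_{k,n})+a_{n,n}f(1)$ with $0<\tau_{0,n}<\dots<\tau_{n-1,n}<1$ and $R[Q_{n+1}^{R,r};f]=0$ for all $f\in S_{n,3}$. It is known explicitly: $\tau_{k,n}=(k+\theta_k)/n$ and $a_{k,n}=\frac{1}{6n\theta_k(1-\theta_k)}$ for $k=0,\dots,n-1$, and $a_{n,n}=\frac{2-3\theta_{n-1}}{6n(1-\theta_{n-1})}$, where $\theta_0=1/3$ and $\theta_k=\frac{1-\theta_{k-1}}{5-6\theta_{k-1}}$ for $k\ge1$. The left Radau formula $Q_{n+1}^{R,l}$ is its reflection,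 $Q_{n+1}^{R,l}[f]=Q_{n+1}^{R,r}[f(1-\cdot)]$; it has a node at $0$ and is likewise exact on $S_{n,3}$. The formulae $Q_{2n+1}^{R,*}$ are those associated with $S_{2n,3}$. Error constant. A quadrature formula $Q$ is definite of order $r$ if there is a constant $c_r(Q)\neq0$ such that for every $f\in C^r[0,1]$ there is $\xi\in[0,1]$ with $R[Q;f]=c_r(Q)f^{(r)}(\xi)$; $c_r(Q)$ is called the error constant of $Q$. It is known that $Q_{n+1}^{R,r}$ and $Q_{n+1}^{R,l}$ are definite of order three (with negative, respectively positive, error constant). Sobolev class. $W_1^3[0,1]$ is the set of $f\in C^2[0,1]$ such that $f''$ is absolutely continuous and $\int_0^1|f'''(t)|\,dt<\infty$. *)

theory Defs
  imports
    "HOL-Analysis.Analysis"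
    "HOL-Library.Landau_Symbols"
    "HOL-Computational_Algebra.Polynomial"
begin

definition remainder :: "((real \<Rightarrow> real) \<Rightarrow> real) \<Rightarrow> (real \<Rightarrow> real) \<Rightarrow> real" where
  "remainder Q f = integral {0..1} f - Q f"

definition quadratic_splines :: "nat \<Rightarrow> (real \<Rightarrow> real) set" where
  "quadratic_splines n = {f. continuous_on {0..1} f \<and>
     (\<forall>k<n. \<exists>p :: real poly. degree p \<le> 2 \<and>
        (\<forall>x\<in>{real k / real n <..< real (Suc k) / real n}. f x = poly p x))}"

text \<open>
  A formula is identified with the functional it defines, so uniqueness is uniqueness of the
  functional. The index \<open>n\<close> is the number of subintervals: the formula has \<open>n + 1\<close> points.
\<close>

definition is_right_radau :: "nat \<Rightarrow> ((real \<Rightarrow> real) \<Rightarrow> real) \<Rightarrow> bool" where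
  "is_right_radau n Q \<longleftrightarrow>
     (\<exists>(a :: nat \<Rightarrow> real) (\<tau> :: nat \<Rightarrow> real).
        strict_mono_on {..<n} \<tau> \<and> (\<forall>k<n. 0 < \<tau> k \<and> \<tau> k < 1) \<and>
        Q = (\<lambda>f. (\<Sum>k<n. a k * f (\<tau> k)) + a n * f 1)) \<and>
     (\<forall>f\<in>quadratic_splines n. remainder Q f = 0)"

definition radau_right :: "nat \<Rightarrow> (real \<Rightarrow> real) \<Rightarrow> real" where
  "radau_right n = (THE Q. is_right_radau n Q)"

definition radau_left :: "nat \<Rightarrow> (real \<Rightarrow> real) \<Rightarrow> real" where
  "radau_left n = (\<lambda>f. radau_right n (\<lambda>x. f (1 - x)))"

text \<open>
  The derivative on \<open>[0,1]\<close> is one-sided at the end points. Its value at a point of \<open>[0,1]\<close> is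
  meaningful only where the function is differentiable within \<open>[0,1]\<close>.
\<close>

definition deriv01 :: "(real \<Rightarrow> real) \<Rightarrow> real \<Rightarrow> real" where
  "deriv01 f = (\<lambda>x. vector_derivative f (at x within {0..1}))"

definition C_class :: "nat \<Rightarrow> (real \<Rightarrow> real) set" where
  "C_class r = {f.
     (\<forall>i<r. \<forall>x\<in>{0..1}. (deriv01 ^^ i) f differentiable (at x within {0..1})) \<and>
     continuous_on {0..1} ((deriv01 ^^ r) f)}"

definition is_error_constant :: "nat \<Rightarrow> ((real \<Rightarrow> real) \<Rightarrow> real) \<Rightarrow> real \<Rightarrow> bool" where
  "is_error_constant r Q c \<longleftrightarrow> c \<noteq> 0 \<and>
     (\<forall>f\<in>C_class r. \<exists>\<xi>\<in>{0..1}. remainder Q f = c * (deriv01 ^^ r) f \<xi>)"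

definition definite :: "nat \<Rightarrow> ((real \<Rightarrow> real) \<Rightarrow> real) \<Rightarrow> bool" where
  "definite r Q \<longleftrightarrow> (\<exists>c. is_error_constant r Q c)"

definition error_constant :: "nat \<Rightarrow> ((real \<Rightarrow> real) \<Rightarrow> real) \<Rightarrow> real" where
  "error_constant r Q = (THE c. is_error_constant r Q c)"

text \<open>
  Absolute continuity of a function (the constant \<^const>\<open>absolutely_continuous\<close> is about measures).
\<close>

definition abs_continuous_on :: "real set \<Rightarrow> (real \<Rightarrow> real) \<Rightarrow> bool" where
  "abs_continuous_on S g \<longleftrightarrow>
     (\<forall>\<epsilon>>0. \<exists>\<delta>>0. \<forall>(m :: nat) (u :: nat \<Rightarrow> real) (v :: nat \<Rightarrow> real).
        (\<forall>i<m. u i \<le> v i \<and> {u i..v i} \<subseteq> S) \<longrightarrow>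
        disjoint_family_on (\<lambda>i. {u i<..<v i}) {..<m} \<longrightarrow>
        (\<Sum>i<m. v i - u i) < \<delta> \<longrightarrow>
        (\<Sum>i<m. \<bar>g (v i) - g (u i)\<bar>) < \<epsilon>)"

definition sobolev_1_3 :: "(real \<Rightarrow> real) set" where
  "sobolev_1_3 = {f. f \<in> C_class 2 \<and> abs_continuous_on {0..1} ((deriv01 ^^ 2) f) \<and>
     (deriv01 ^^ 3) f absolutely_integrable_on {0..1}}"

text \<open>
  The third derivative exists and is nonnegative almost everywhere. On \<^const>\<open>sobolev_1_3\<close> the
  existence is automatic; it is spelled out because \<^const>\<open>deriv01\<close> is arbitrary where the
  derivative does not exist.
\<close>

definition third_deriv_nonneg_ae :: "(real \<Rightarrow> real) \<Rightarrow> bool" where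
  "third_deriv_nonneg_ae f \<longleftrightarrow>
     (AE t in lebesgue_on {0..1}.
        (deriv01 ^^ 2) f differentiable (at t within {0..1}) \<and> (deriv01 ^^ 3) f t \<ge> 0)"

end

theory Submission
  imports Defs
begin

text \<open>
  On a cell, let the rule with nodes \<open>0\<close>, \<open>\<theta>\<close>, \<open>1\<close> be exact on quadratics. With \<open>\<theta>\<^sub>k\<close> from the recursion,
  the weights of neighbouring cells at their common knot cancel, as does the weight at \<open>0\<close>, so the
  right Radau formula is the composite of these cell rules and its remainder is the sum of their
  remainders. The Peano kernel of a cell rule is nonpositive and its integral is \<open>-(1 - 2\<theta>\<^sub>k)/72\<close>,
  where \<open>1 - 2\<theta>\<^sub>k = (p - 1) / (\<surd>3 (p + 1))\<close> with \<open>p = (2 + \<surd>3)\<^bsup>2k+1\<^esup>\<close>; this gives (a), and since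
  \<open>1 - 2\<theta>\<^sub>k\<close> converges geometrically, a Riemann sum argument shows
  \<open>n\<^sup>3 R[f] \<longlonglongrightarrow> -\<surd>3/216 (f''(1) - f''(0))\<close>, which gives (b). The \<open>\<theta>\<^sub>k\<close> do not depend on \<open>n\<close>, so (c) reduces
  to comparing the kernel of cell \<open>k\<close> with those of its halves, the cells \<open>2k\<close> and \<open>2k + 1\<close>.
\<close>

section \<open>Absolutely continuous functions\<close>

text \<open>The obstacle is (c): there f''' exists only almost everywhere, so a Peano representation
  by f''' would require integration theory for absolutely continuous functions. The proof is
  therefore built on the inequality "f'' nondecreasing implies a signed remainder", in which f'''
  does not occur: the second mean value theorem turns a one-signed kernel into a one-signed
  functional. Absolute continuity serves only to make f'' nondecreasing. The mean value statements
  for C^3 are drawn from the same inequality by adding or subtracting a cubic, and the left formulae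
  from the right ones by reflection.\<close>

text \<open>
  Take a tagged division fine for a gauge that makes difference quotients at good tags at least
  \<open>-e\<close> and squeezes the intervals tagged in \<open>N\<close> into an open set of small measure, where
  absolute continuity bounds the variation.
\<close>

lemma abs_continuous_on_nondecreasing:
  fixes g g' :: "real \<Rightarrow> real"
  assumes ac: "abs_continuous_on S g" and "a \<le> b" and ab: "{a..b} \<subseteq> S" and N: "negligible N"
    and der: "\<And>t. t \<in> {a..b} - N \<Longrightarrow> (g has_real_derivative g' t) (at t within S)"
    and nonneg: "\<And>t. t \<in> {a..b} - N \<Longrightarrow> 0 \<le> g' t"
  shows "g a \<le> g b"
proof -
  \<comment> \<open>Straddle estimate: since u <= t <= v, the errors e * (t - u) and e * (v - t) at
    the two ends add up to e * (v - u).\<close>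
  have slope: "\<exists>d>0. \<forall>u v. u \<in> S \<and> v \<in> S \<and> u \<le> t \<and> t \<le> v \<and> {u..v} \<subseteq> ball t d
                 \<longrightarrow> - (e * (v - u)) \<le> g v - g u"
    if t: "t \<in> {a..b} - N" and "0 < e" for t e :: real
  proof -
    have "(g has_derivative (\<lambda>h. h * g' t)) (at t within S)"
      using der[OF t] by (simp add: has_field_derivative_def mult_commute_abs)
    then have "\<forall>e>0. \<exists>d>0. \<forall>y\<in>S. \<bar>y - t\<bar> < d \<longrightarrow> \<bar>g y - g t - (y - t) * g' t\<bar> \<le> e * \<bar>y - t\<bar>"
      unfolding has_derivative_within_alt real_norm_def by blast
    with \<open>0 < e\<close> obtain d where "d > 0"
      and d: "\<And>y. \<lbrakk>y \<in> S; \<bar>y - t\<bar> < d\<rbrakk> \<Longrightarrow> \<bar>g y - g t - (y - t) * g' t\<bar> \<le> e * \<bar>y - t\<bar>"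
      by blast
    have "- (e * (v - u)) \<le> g v - g u"
      if uv: "u \<in> S" "v \<in> S" "u \<le> t" "t \<le> v" "{u..v} \<subseteq> ball t d" for u v
    proof -
      have "u \<in> ball t d" "v \<in> ball t d"
        using uv by (meson atLeastAtMost_iff order_refl order_trans subsetD)+
      then have "\<bar>g u - g t - (u - t) * g' t\<bar> \<le> e * (t - u)"
        and "\<bar>g v - g t - (v - t) * g' t\<bar> \<le> e * (v - t)"
        using d[of u] d[of v] uv by (auto simp: dist_real_def)
      moreover have "(u - t) * g' t \<le> 0" "0 \<le> (v - t) * g' t"
        using nonneg[OF t] uv by (auto simp: mult_nonneg_nonneg mult_nonpos_nonneg)
      ultimately show ?thesis
        by (simp add: algebra_simps abs_le_iff)
    qed
    then show ?thesis
      using \<open>d > 0\<close> by blast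
  qed
  have approx: "g a - g b \<le> e * (b - a) + e" if "0 < e" for e
  proof -
    obtain \<delta> where "\<delta> > 0"
      and \<delta>: "\<And>(m::nat) u v. \<lbrakk>\<forall>i<m. u i \<le> v i \<and> {u i..v i} \<subseteq> S;
             disjoint_family_on (\<lambda>i. {u i<..<v i}) {..<m}; (\<Sum>i<m. v i - u i) < \<delta>\<rbrakk>
           \<Longrightarrow> (\<Sum>i<m. \<bar>g (v i) - g (u i)\<bar>) < e"
      using ac[unfolded abs_continuous_on_def, rule_format, OF \<open>0 < e\<close>] by blast
    have "N \<in> null_sets lebesgue"
      using N by (simp add: negligible_iff_null_sets)
    \<comment> \<open>Since \<open>N\<close> is null, \<open>T\<close> has the same measure as
      \<open>T - N\<close>, so this is an open cover of \<open>N\<close> of measure below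
      \<delta>.\<close>
    then obtain T where T: "open T" "N \<subseteq> T" "T - N \<in> lmeasurable"
        "emeasure lebesgue (T - N) < ennreal \<delta>"
      using sets_lebesgue_outer_open[of N \<delta>] \<open>\<delta> > 0\<close> by auto
    have Tm: "T \<in> lmeasurable"
      using T \<open>N \<in> null_sets lebesgue\<close>
      by (metis Diff_partition fmeasurable.Un negligible_iff_null_sets negligible_imp_measurable N)
    have "measure lebesgue T = measure lebesgue (T - N)"
      using \<open>N \<in> null_sets lebesgue\<close> Tm by (simp add: measure_Diff_null_set)
    also have "\<dots> < \<delta>"
      using T \<open>\<delta> > 0\<close> by (metis emeasure_eq_measure2 ennreal_less_iff measure_nonneg)
    finally have T\<delta>: "measure lebesgue T < \<delta>" .
    obtain d where d: "\<And>t. t \<in> {a..b} - N \<Longrightarrow> d t > 0 \<and>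
        (\<forall>u v. u \<in> S \<and> v \<in> S \<and> u \<le> t \<and> t \<le> v \<and> {u..v} \<subseteq> ball t (d t)
                 \<longrightarrow> - (e * (v - u)) \<le> g v - g u)"
      using slope[OF _ \<open>0 < e\<close>] by metis
    \<comment> \<open>The last case only makes \<gamma> a gauge on the whole line; tags of a
      division of [a, b] never fall under it.\<close>
    define \<gamma> where "\<gamma> t = (if t \<in> N then T else if t \<in> {a..b} then ball t (d t) else ball t 1)" for t
    have "gauge \<gamma>"
      using T d unfolding gauge_def \<gamma>_def by (auto split: if_splits)
    then obtain p where p: "p tagged_division_of {a..b}" "\<gamma> fine p"
      using fine_division_exists_real by blast
    have fin: "finite p"
      using p(1) by (rule tagged_division_of_finite)
    have pD: "\<exists>u v. K = {u..v} \<and> u \<le> x \<and> x \<le> v \<and> a \<le> u \<and> v \<le> b \<and> K \<subseteq> \<gamma> x"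
      if "(x, K) \<in> p" for x K
    proof -
      have "\<exists>u v. K = cbox u v"
        using p(1) that by (rule tagged_division_ofD(4))
      then obtain u v where "K = {u..v}"
        by auto
      moreover have "x \<in> K" "K \<subseteq> {a..b}"
        using tagged_division_ofD(2,3)[OF p(1) that] by auto
      moreover have "K \<subseteq> \<gamma> x"
        using fineD[OF p(2) that] .
      ultimately show ?thesis
        by auto
    qed
    define B where "B = {z \<in> p. fst z \<in> N}"
    have "finite B" "B \<subseteq> p"
      using fin by (auto simp: B_def)
    \<comment> \<open>Absolute continuity is phrased for families indexed by i < m, so the bad
      intervals are numbered.\<close>
    then obtain h :: "nat \<Rightarrow> real \<times> real set" and m where h: "bij_betw h {..<m} B"
      by (metis bij_betw_from_nat_into_finite)
    define u v where "u i = Inf (snd (h i))" and "v i = Sup (snd (h i))" for i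
    have hB: "fst (h i) \<in> N \<and> h i \<in> p \<and> snd (h i) = {u i..v i} \<and> u i \<le> v i \<and> a \<le> u i \<and> v i \<le> b
        \<and> {u i..v i} \<subseteq> T" if "i < m" for i
    proof -
      have "h i \<in> B"
        using h that by (auto simp: bij_betw_def)
      then show ?thesis
        using pD[of "fst (h i)" "snd (h i)"] by (auto simp: B_def u_def v_def \<gamma>_def)
    qed
    have disj: "disjoint_family_on (\<lambda>i. {u i<..<v i}) {..<m}"
    proof (unfold disjoint_family_on_def, intro ballI impI)
      fix i j assume ij: "i \<in> {..<m}" "j \<in> {..<m}" "i \<noteq> j"
      then have "h i \<noteq> h j"
        using h by (metis bij_betw_def inj_on_eq_iff)
      then have "interior (snd (h i)) \<inter> interior (snd (h j)) = {}"
        using tagged_division_ofD(5)[OF p(1), of "fst (h i)" "snd (h i)" "fst (h j)" "snd (h j)"] hB ij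
        by auto
      then show "{u i<..<v i} \<inter> {u j<..<v j} = {}"
        using hB ij by (auto simp: interior_atLeastAtMost_real)
    qed
    have "(\<Sum>i<m. v i - u i) = (\<Sum>i<m. measure lebesgue {u i<..<v i})"
      using hB by (intro sum.cong) auto
    also have "\<dots> = measure lebesgue (\<Union>i<m. {u i<..<v i})"
      by (rule measure_finite_Union[symmetric])
        (use disj hB in \<open>auto simp: emeasure_lborel_Ioo\<close>)
    also have "\<dots> \<le> measure lebesgue T"
    proof (rule measure_mono_fmeasurable)
      show "(\<Union>i<m. {u i<..<v i}) \<subseteq> T"
        using hB by (fastforce simp: subset_iff)
    qed (use Tm in auto)
    finally have "(\<Sum>i<m. v i - u i) < \<delta>"
      using T\<delta> by simp
    then have "(\<Sum>i<m. \<bar>g (v i) - g (u i)\<bar>) < e"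
      using hB ab by (intro \<delta> disj) fastforce+
    moreover have "(\<Sum>i<m. \<bar>g (v i) - g (u i)\<bar>) = (\<Sum>z\<in>B. \<bar>g (Sup (snd z)) - g (Inf (snd z))\<bar>)"
      unfolding u_def v_def by (rule sum.reindex_bij_betw[OF h])
    ultimately have bad: "(\<Sum>z\<in>B. \<bar>g (Sup (snd z)) - g (Inf (snd z))\<bar>) < e"
      by simp
    have good: "- (e * (Sup (snd z) - Inf (snd z))) \<le> g (Sup (snd z)) - g (Inf (snd z))"
      if z: "z \<in> p - B" for z
    proof -
      obtain x K where [simp]: "z = (x, K)"
        by fastforce
      then obtain u v where uv: "K = {u..v}" "u \<le> x" "x \<le> v" "a \<le> u" "v \<le> b" "K \<subseteq> \<gamma> x"
        using pD z by blast
      have "x \<in> {a..b} - N"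
        using uv z by (auto simp: B_def)
      then show ?thesis
        using d[of x] uv ab by (auto simp: \<gamma>_def subset_iff)
    qed
    have len: "0 \<le> Sup (snd z) - Inf (snd z)" if "z \<in> p" for z
      using pD[of "fst z" "snd z"] that by auto
    have eq: "g b - g a = (\<Sum>z\<in>p - B. g (Sup (snd z)) - g (Inf (snd z)))
        + (\<Sum>z\<in>B. g (Sup (snd z)) - g (Inf (snd z)))"
      using additive_tagged_division_1[OF \<open>a \<le> b\<close> p(1), of g]
      unfolding sum.subset_diff[OF \<open>B \<subseteq> p\<close> fin, symmetric] by (simp add: case_prod_beta)
    have "(\<Sum>z\<in>p - B. - (e * (Sup (snd z) - Inf (snd z))))
        \<le> (\<Sum>z\<in>p - B. g (Sup (snd z)) - g (Inf (snd z)))"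
      by (intro sum_mono good)
    moreover have "(\<Sum>z\<in>B. - \<bar>g (Sup (snd z)) - g (Inf (snd z))\<bar>)
        \<le> (\<Sum>z\<in>B. g (Sup (snd z)) - g (Inf (snd z)))"
      by (intro sum_mono) auto
    moreover have "(\<Sum>z\<in>p - B. e * (Sup (snd z) - Inf (snd z)))
        \<le> (\<Sum>z\<in>p. e * (Sup (snd z) - Inf (snd z)))"
      using len \<open>0 < e\<close> fin by (intro sum_mono2) auto
    moreover have "(\<Sum>z\<in>p. Sup (snd z) - Inf (snd z)) = b - a"
      using additive_tagged_division_1[OF \<open>a \<le> b\<close> p(1), of "\<lambda>x. x"]
      unfolding case_prod_beta .
    ultimately show ?thesis
      using bad eq unfolding sum_negf sum_distrib_left[symmetric] by simp
  qed
  show ?thesis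
  proof (rule ccontr)
    assume "\<not> g a \<le> g b"
    \<comment> \<open>The \<open>+ 1\<close> absorbs the second summand of \<open>approx\<close>:
      its bound becomes half of \<open>g a - g b\<close>.\<close>
    define e where "e = (g a - g b) / 2 / (b - a + 1)"
    have "e > 0"
      using \<open>\<not> g a \<le> g b\<close> \<open>a \<le> b\<close> by (simp add: e_def)
    moreover have "e * (b - a) + e = (g a - g b) / 2"
    proof -
      have "e * (b - a) + e = e * (b - a + 1)"
        by (simp add: algebra_simps)
      also have "\<dots> = (g a - g b) / 2"
        using \<open>a \<le> b\<close> unfolding e_def by (subst nonzero_eq_divide_eq[symmetric]) auto
      finally show ?thesis .
    qed
    ultimately show False
      using approx[of e] \<open>\<not> g a \<le> g b\<close> by simp
  qed
qed

section \<open>Peano kernels and nondecreasing second derivatives\<close>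

text \<open>The derivatives are explicit arguments, so that rescaling to a cell, reflection and
  subtraction of a cubic act on them by formulas; iterated \<open>deriv01\<close> would have to be
  recomputed each time.\<close>

definition C2_derivs :: "(real \<Rightarrow> real) \<Rightarrow> (real \<Rightarrow> real) \<Rightarrow> (real \<Rightarrow> real) \<Rightarrow> bool" where
  "C2_derivs g g1 g2 \<longleftrightarrow>
     (\<forall>x\<in>{0..1}. (g has_real_derivative g1 x) (at x within {0..1})) \<and>
     (\<forall>x\<in>{0..1}. (g1 has_real_derivative g2 x) (at x within {0..1})) \<and>
     continuous_on {0..1} g2"

lemma C2_derivs_continuous:
  assumes "C2_derivs g g1 g2"
  shows "continuous_on {0..1} g" "continuous_on {0..1} g1" "continuous_on {0..1} g2"
  using assms unfolding C2_derivs_def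
  by (auto intro!: DERIV_continuous_on)

text \<open>\<open>h\<close> may be negative: restriction to a cell and the reflection x -> 1 - x
  are both instances.\<close>

lemma C2_derivs_affine:
  assumes "C2_derivs g g1 g2" and h: "\<And>s. s \<in> {0..1} \<Longrightarrow> a + h * s \<in> {0..1}"
  shows "C2_derivs (\<lambda>s. g (a + h * s)) (\<lambda>s. h * g1 (a + h * s)) (\<lambda>s. h\<^sup>2 * g2 (a + h * s))"
proof -
  have chain: "((\<lambda>s. f (a + h * s)) has_real_derivative h * f' (a + h * s)) (at s within {0..1})"
    if f: "\<forall>x\<in>{0..1}. (f has_real_derivative f' x) (at x within {0..1})" and s: "s \<in> {0..1}"
    for f f' s
  proof -
    have "(\<lambda>s. a + h * s) ` {0..1} \<subseteq> {0..1}"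
      using h by blast
    then have "(f has_real_derivative f' (a + h * s)) (at (a + h * s) within (\<lambda>s. a + h * s) ` {0..1})"
      using f h s by (meson DERIV_subset)
    moreover have "((\<lambda>s. a + h * s) has_real_derivative h) (at s within {0..1})"
      by (auto intro!: derivative_eq_intros)
    ultimately show ?thesis
      using DERIV_image_chain[of f "f' (a + h * s)" "\<lambda>s. a + h * s" s "{0..1}" h]
      by (simp add: o_def mult.commute)
  qed
  have "continuous_on {0..1} (\<lambda>s. h\<^sup>2 * g2 (a + h * s))"
    by (intro continuous_intros continuous_on_compose2[OF C2_derivs_continuous(3)[OF assms(1)]])
      (use h in blast)
  moreover have "((\<lambda>s. h * g1 (a + h * s)) has_real_derivative h\<^sup>2 * g2 (a + h * s)) (at s within {0..1})"
    if "s \<in> {0..1}" for s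
    using DERIV_cmult[OF chain[of g1 g2 s], of h] assms(1) that
    by (simp add: C2_derivs_def power2_eq_square mult.assoc)
  ultimately show ?thesis
    using assms(1) chain unfolding C2_derivs_def by blast
qed

text \<open>For c = 1 and c = -1, a bound on the third derivative of \<open>g\<close> becomes
  monotonicity of the second derivative of the new function.\<close>

lemma C2_derivs_diff_cubic:
  assumes "C2_derivs g g1 g2"
  shows "C2_derivs (\<lambda>x. c * g x - k * x ^ 3 / 6) (\<lambda>x. c * g1 x - k * x\<^sup>2 / 2) (\<lambda>x. c * g2 x - k * x)"
  using assms unfolding C2_derivs_def
  by (auto intro!: derivative_eq_intros continuous_intros)

text \<open>A discrete functional as a list of weight-node pairs: concrete rules with three or five
  nodes unfold by simplification, and no order of the nodes is imposed.\<close>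

fun point_sum :: "(real \<times> real) list \<Rightarrow> (real \<Rightarrow> real) \<Rightarrow> real" where
  "point_sum [] f = 0"
| "point_sum ((w, m) # ws) f = w * f m + point_sum ws f"

lemma point_sum_cong:
  "\<forall>(w, m)\<in>set ws. f m = g m \<Longrightarrow> point_sum ws f = point_sum ws g"
  by (induction ws f rule: point_sum.induct) auto

lemma point_sum_add: "point_sum ws (\<lambda>m. f m + g m) = point_sum ws f + point_sum ws g"
  by (induction ws f rule: point_sum.induct) (auto simp: algebra_simps)

lemma point_sum_mult: "point_sum ws (\<lambda>m. c * f m) = c * point_sum ws f"
  by (induction ws f rule: point_sum.induct) (auto simp: algebra_simps)

lemma has_integral_point_sum:
  assumes "\<And>w m. (w, m) \<in> set ws \<Longrightarrow> ((\<lambda>t. f m t) has_integral I m) S"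
  shows "((\<lambda>t. point_sum ws (\<lambda>m. f m t)) has_integral point_sum ws I) S"
  using assms
proof (induction ws I rule: point_sum.induct)
  case (2 w m ws f)
  then show ?case
    by (auto intro!: has_integral_add has_integral_mult_right)
qed simp

lemma has_integral_truncated:
  fixes h :: "real \<Rightarrow> real"
  assumes "a \<le> m" "m \<le> b" and I: "((\<lambda>t. (t - m) * h t) has_integral I) {m..b}"
  shows "((\<lambda>t. max 0 (t - m) * h t) has_integral I) {a..b}"
proof -
  have "((\<lambda>t. max 0 (t - m) * h t) has_integral 0) {a..m}"
    by (rule has_integral_eq[OF _ has_integral_0]) auto
  moreover have "((\<lambda>t. max 0 (t - m) * h t) has_integral I) {m..b}"
    by (rule has_integral_eq[OF _ I]) auto
  ultimately show ?thesis
    using has_integral_combine[OF assms(1,2), of _ 0 I] by simp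
qed

text \<open>Taylor's formula for \<open>g m\<close> about 1 with integral remainder; on [m, 1] the
  integrand has the antiderivative \<open>(t - m) * g1 t - g t\<close>.\<close>

lemma has_integral_truncated_deriv2:
  assumes g: "C2_derivs g g1 g2" and m: "m \<in> {0..1}"
  shows "((\<lambda>t. max 0 (t - m) * g2 t) has_integral (1 - m) * g1 1 - g 1 + g m) {0..1}"
proof (rule has_integral_truncated)
  have "((\<lambda>t. (t - m) * g2 t) has_integral
          ((1 - m) * g1 1 - g 1) - ((m - m) * g1 m - g m)) {m..1}"
  proof (rule fundamental_theorem_of_calculus)
    fix x assume x: "x \<in> {m..1}"
    then have "x \<in> {0..1}"
      using m by auto
    then have "(g has_real_derivative g1 x) (at x within {0..1})"
      "(g1 has_real_derivative g2 x) (at x within {0..1})"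
      using g unfolding C2_derivs_def by blast+
    moreover have "{m..1} \<subseteq> {0..1}"
      using m by auto
    ultimately have "(g has_real_derivative g1 x) (at x within {m..1})"
      "(g1 has_real_derivative g2 x) (at x within {m..1})"
      by (blast intro: DERIV_subset)+
    then have "((\<lambda>t. (t - m) * g1 t - g t) has_real_derivative (x - m) * g2 x) (at x within {m..1})"
      by (auto intro!: derivative_eq_intros)
    then show "((\<lambda>t. (t - m) * g1 t - g t) has_vector_derivative (x - m) * g2 x) (at x within {m..1})"
      by (simp add: has_real_derivative_iff_has_vector_derivative)
  qed (use m in simp)
  then show "((\<lambda>t. (t - m) * g2 t) has_integral (1 - m) * g1 1 - g 1 + g m) {m..1}"
    by simp
qed (use m in auto)

text \<open>The same Taylor formula averaged over m in [0, 1], where max 0 (t - m) integrates to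
  t^2/2; proved directly by parts.\<close>

lemma has_integral_square_deriv2:
  assumes g: "C2_derivs g g1 g2"
  shows "((\<lambda>t. t\<^sup>2 / 2 * g2 t) has_integral g1 1 / 2 - g 1 + integral {0..1} g) {0..1}"
proof -
  have "((\<lambda>t. t\<^sup>2 / 2 * g2 t - g t) has_integral (1\<^sup>2 / 2 * g1 1 - 1 * g 1) - (0\<^sup>2 / 2 * g1 0 - 0 * g 0)) {0..1}"
  proof (rule fundamental_theorem_of_calculus)
    fix x :: real assume "x \<in> {0..1}"
    then have "(g has_real_derivative g1 x) (at x within {0..1})"
      "(g1 has_real_derivative g2 x) (at x within {0..1})"
      using g unfolding C2_derivs_def by auto
    then have "((\<lambda>t. t\<^sup>2 / 2 * g1 t - t * g t) has_real_derivative x\<^sup>2 / 2 * g2 x - g x) (at x within {0..1})"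
      by (auto intro!: derivative_eq_intros simp: algebra_simps)
    then show "((\<lambda>t. t\<^sup>2 / 2 * g1 t - t * g t) has_vector_derivative x\<^sup>2 / 2 * g2 x - g x) (at x within {0..1})"
      by (simp add: has_real_derivative_iff_has_vector_derivative)
  qed simp
  moreover have "(g has_integral integral {0..1} g) {0..1}"
    using C2_derivs_continuous(1)[OF g] by (auto intro: integrable_integral integrable_continuous_interval)
  ultimately have "((\<lambda>t. (t\<^sup>2 / 2 * g2 t - g t) + g t) has_integral
      (1\<^sup>2 / 2 * g1 1 - 1 * g 1) - (0\<^sup>2 / 2 * g1 0 - 0 * g 0) + integral {0..1} g) {0..1}"
    by (rule has_integral_add)
  then show ?thesis
    by simp
qed

text \<open>
  The last factor is the third order Peano kernel of the functional. Its derivative is integrated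
  against the monotone \<open>g2\<close> by the second mean value theorem, so no third derivative is needed.
\<close>

lemma peano_mean_value:
  assumes g: "C2_derivs g g1 g2"
    and mono: "\<And>x y. \<lbrakk>0 \<le> x; x \<le> y; y \<le> 1\<rbrakk> \<Longrightarrow> g2 x \<le> g2 y"
    and m: "\<And>w m. (w, m) \<in> set ws \<Longrightarrow> m \<in> {0..1}"
    and exact: "point_sum ws (\<lambda>m. 1) = c" "point_sum ws (\<lambda>m. m) = c / 2"
      "point_sum ws (\<lambda>m. m\<^sup>2) = c / 3"
  shows "\<exists>x\<in>{0..1}. c * integral {0..1} g - point_sum ws g
           = (g2 1 - g2 0) * (point_sum ws (\<lambda>m. (max 0 (x - m))\<^sup>2) / 2 - c * x ^ 3 / 6)"
proof -
  \<comment> \<open>\<open>N\<close> is the second order kernel of the negative of the functional,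
    and \<open>K\<close> is its primitive vanishing at 0.\<close>
  define N where "N t = point_sum ws (\<lambda>m. max 0 (t - m)) - c * (t\<^sup>2 / 2)" for t
  define K where "K x = point_sum ws (\<lambda>m. (max 0 (x - m))\<^sup>2) / 2 - c * x ^ 3 / 6" for x
  have N_g2: "((\<lambda>t. g2 t * N t) has_integral
      point_sum ws (\<lambda>m. (1 - m) * g1 1 - g 1 + g m) - c * (g1 1 / 2 - g 1 + integral {0..1} g)) {0..1}"
  proof -
    have "((\<lambda>t. point_sum ws (\<lambda>m. max 0 (t - m) * g2 t) - c * (t\<^sup>2 / 2 * g2 t)) has_integral
      point_sum ws (\<lambda>m. (1 - m) * g1 1 - g 1 + g m) - c * (g1 1 / 2 - g 1 + integral {0..1} g)) {0..1}"
      by (intro has_integral_diff has_integral_point_sum has_integral_mult_right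
          has_integral_truncated_deriv2[OF g] has_integral_square_deriv2[OF g] m)
    moreover have "point_sum ws (\<lambda>m. max 0 (t - m) * g2 t) - c * (t\<^sup>2 / 2 * g2 t) = g2 t * N t" for t
      unfolding N_def using point_sum_mult[of ws "g2 t" "\<lambda>m. max 0 (t - m)"]
      by (simp add: algebra_simps)
    ultimately show ?thesis
      by simp
  qed
  have "point_sum ws (\<lambda>m. (1 - m) * g1 1 - g 1 + g m)
      = point_sum ws (\<lambda>m. (g1 1 - g 1) * 1 + ((- g1 1) * m + g m))"
    by (intro point_sum_cong) (simp add: algebra_simps)
  also have "\<dots> = (g1 1 - g 1) * c - g1 1 * (c / 2) + point_sum ws g"
    unfolding point_sum_add point_sum_mult exact by simp
  finally have N_g2': "((\<lambda>t. g2 t * N t) has_integral point_sum ws g - c * integral {0..1} g) {0..1}"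
    using N_g2 by (simp add: algebra_simps)
  have N_int: "(N has_integral K x) {0..x}" if x: "x \<in> {0..1}" for x
  proof -
    have trunc: "((\<lambda>t. max 0 (t - m)) has_integral (max 0 (x - m))\<^sup>2 / 2) {0..x}" if "m \<in> {0..1}" for m
    proof (cases "m \<le> x")
      case True
      have "((\<lambda>t. (t - m) * 1) has_integral ((x - m)\<^sup>2 / 2 - (m - m)\<^sup>2 / 2)) {m..x}"
        using True by (intro fundamental_theorem_of_calculus)
          (auto intro!: derivative_eq_intros simp flip: has_real_derivative_iff_has_vector_derivative)
      then have "((\<lambda>t. max 0 (t - m) * 1) has_integral (x - m)\<^sup>2 / 2) {0..x}"
        using True that by (intro has_integral_truncated) auto
      then show ?thesis
        using True by simp
    next
      case False
      then have "((\<lambda>t. max 0 (t - m)) has_integral 0) {0..x}"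
        by (intro has_integral_eq[OF _ has_integral_0]) auto
      then show ?thesis
        using False by simp
    qed
    have "((\<lambda>t. t\<^sup>2 / 2) has_integral (x ^ 3 / 6 - 0 ^ 3 / 6)) {0..x}"
      using x by (intro fundamental_theorem_of_calculus)
        (auto intro!: derivative_eq_intros simp flip: has_real_derivative_iff_has_vector_derivative)
    then have "(N has_integral point_sum ws (\<lambda>m. (max 0 (x - m))\<^sup>2 / 2) - c * (x ^ 3 / 6)) {0..x}"
      unfolding N_def by (intro has_integral_diff has_integral_point_sum has_integral_mult_right trunc m) auto
    moreover have "point_sum ws (\<lambda>m. (max 0 (x - m))\<^sup>2 / 2) = point_sum ws (\<lambda>m. (max 0 (x - m))\<^sup>2) / 2"
      using point_sum_mult[of ws "1/2" "\<lambda>m. (max 0 (x - m))\<^sup>2"] by simp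
    ultimately show ?thesis
      by (simp add: K_def)
  qed
  \<comment> \<open>Exactness on quadratics makes the kernel vanish at 1 as well.\<close>
  have "point_sum ws (\<lambda>m. (max 0 (1 - m))\<^sup>2) = point_sum ws (\<lambda>m. 1 + ((- 2) * m + m\<^sup>2))"
  proof (rule point_sum_cong, clarify)
    fix w a assume "(w, a) \<in> set ws"
    then have "a \<le> 1"
      using m by fastforce
    then show "(max 0 (1 - a))\<^sup>2 = 1 + ((- 2) * a + a\<^sup>2)"
      by (simp add: power2_eq_square algebra_simps)
  qed
  also have "\<dots> = c / 3"
    unfolding point_sum_add point_sum_mult exact by simp
  finally have K1: "K 1 = 0"
    by (simp add: K_def)
  have N01: "N integrable_on {0..1}"
    using has_integral_integrable[OF N_int[of 1]] by simp
  obtain x where x: "x \<in> {0..1}"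
    and eq: "((\<lambda>t. g2 t * N t) has_integral g2 0 * integral {0..x} N + g2 1 * integral {x..1} N) {0..1}"
    by (rule second_mean_value_theorem_full[OF N01 _ mono]) auto
  \<comment> \<open>As \<open>K 1 = 0\<close>, the two pieces of the mean value are
    \<open>K x\<close> and \<open>- K x\<close>, so only the increment of \<open>g2\<close>
    survives.\<close>
  have "integral {0..x} N + integral {x..1} N = integral {0..1} N"
    using x N01 by (intro Henstock_Kurzweil_Integration.integral_combine) auto
  then have "integral {x..1} N = - K x" "integral {0..x} N = K x"
    using N_int[of 1] N_int[of x] x K1 by (auto simp: integral_unique)
  then have "c * integral {0..1} g - point_sum ws g = (g2 1 - g2 0) * K x"
    using has_integral_unique[OF eq N_g2'] by (simp add: algebra_simps)
  then show ?thesis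
    using x by (auto simp: K_def)
qed

section \<open>The rule on a single cell\<close>

text \<open>
  The rule with nodes \<open>0\<close>, \<open>\<theta>\<close>, \<open>1\<close> on \<open>[0,1]\<close> that is exact on quadratics.
\<close>

definition node_wt :: "real \<Rightarrow> real" where "node_wt \<theta> = 1 / (6 * \<theta> * (1 - \<theta>))"
definition left_wt :: "real \<Rightarrow> real" where "left_wt \<theta> = (3 * \<theta> - 1) / (6 * \<theta>)"
definition right_wt :: "real \<Rightarrow> real" where "right_wt \<theta> = (2 - 3 * \<theta>) / (6 * (1 - \<theta>))"

definition cell_rem :: "real \<Rightarrow> (real \<Rightarrow> real) \<Rightarrow> real" where
  "cell_rem \<theta> g = integral {0..1} g - (node_wt \<theta> * g \<theta> + left_wt \<theta> * g 0 + right_wt \<theta> * g 1)"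

text \<open>The first three identities are exactness on quadratics. In the fourth, (1 - 2
  \<theta>)/12 is the excess on x^3; division by 6, for the cubic with third derivative 1, produces
  the 72 of the error constant.\<close>

lemma cell_wt_moments:
  assumes "0 < \<theta>" "\<theta> < 1"
  shows "node_wt \<theta> + left_wt \<theta> + right_wt \<theta> = 1"
    "node_wt \<theta> * \<theta> + right_wt \<theta> = 1 / 2"
    "node_wt \<theta> * \<theta>\<^sup>2 + right_wt \<theta> = 1 / 3"
    "node_wt \<theta> * \<theta> ^ 3 + right_wt \<theta> = 1 / 4 + (1 - 2 * \<theta>) / 12"
proof -
  have nz: "\<theta> \<noteq> 0" "1 - \<theta> \<noteq> 0"
    using assms by auto
  have c: "6 * \<theta> * (1 - \<theta>) * node_wt \<theta> = 1" "6 * \<theta> * left_wt \<theta> = 3 * \<theta> - 1"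
    "6 * (1 - \<theta>) * right_wt \<theta> = 2 - 3 * \<theta>"
    using nz by (simp_all add: node_wt_def left_wt_def right_wt_def)
  have "6 * \<theta> * (1 - \<theta>) * (node_wt \<theta> + left_wt \<theta> + right_wt \<theta>) = 6 * \<theta> * (1 - \<theta>) * 1"
    using c by algebra
  then show "node_wt \<theta> + left_wt \<theta> + right_wt \<theta> = 1"
    using nz by (metis mult_cancel_left mult_eq_0_iff zero_neq_numeral)
  have "6 * (1 - \<theta>) * (node_wt \<theta> * \<theta>) = 1"
    using c by algebra
  then have n: "node_wt \<theta> * \<theta> = 1 / (6 * (1 - \<theta>))"
    using nz by (simp add: field_simps)
  show "node_wt \<theta> * \<theta> + right_wt \<theta> = 1 / 2"
    unfolding n right_wt_def add_divide_distrib[symmetric] using nz by (simp add: divide_simps)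
  have "node_wt \<theta> * \<theta>\<^sup>2 + right_wt \<theta> = (node_wt \<theta> * \<theta>) * \<theta> + right_wt \<theta>"
    by (simp add: power2_eq_square)
  also have "\<dots> = 1 / 3"
    unfolding n right_wt_def times_divide_eq_left add_divide_distrib[symmetric]
    using nz by (simp add: divide_simps)
  finally show "node_wt \<theta> * \<theta>\<^sup>2 + right_wt \<theta> = 1 / 3" .
  have "node_wt \<theta> * \<theta> ^ 3 + right_wt \<theta> = (node_wt \<theta> * \<theta>) * \<theta>\<^sup>2 + right_wt \<theta>"
    by (simp add: power2_eq_square power3_eq_cube)
  also have "\<dots> = (\<theta>\<^sup>2 + 2 - 3 * \<theta>) / (6 * (1 - \<theta>))"
    unfolding n right_wt_def times_divide_eq_left add_divide_distrib[symmetric] by (simp add: algebra_simps)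
  also have "\<theta>\<^sup>2 + 2 - 3 * \<theta> = (2 - \<theta>) * (1 - \<theta>)"
    by (simp add: power2_eq_square algebra_simps)
  also have "\<dots> / (6 * (1 - \<theta>)) = (2 - \<theta>) / 6"
    using nz by (intro nonzero_mult_divide_mult_cancel_right)
  finally show "node_wt \<theta> * \<theta> ^ 3 + right_wt \<theta> = 1 / 4 + (1 - 2 * \<theta>) / 12"
    by (simp add: field_simps)
qed

text \<open>Apart from positivity, the bounds are the values at the end points of [1/5, 1/3], an
  interval that the recursion never leaves.\<close>

lemma cell_wt_bounds:
  assumes "1 / 5 \<le> \<theta>" "\<theta> \<le> 1 / 3"
  shows "0 < node_wt \<theta>" "left_wt \<theta> \<le> 0" "- 1 / 3 \<le> left_wt \<theta>" "1 / 4 \<le> right_wt \<theta>" "right_wt \<theta> \<le> 7 / 24"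
  using assms by (auto simp: node_wt_def left_wt_def right_wt_def divide_simps)

lemma cell_kernel_nonpos:
  assumes \<theta>: "1 / 5 \<le> \<theta>" "\<theta> \<le> 1 / 3" and x: "0 \<le> x" "x \<le> 1"
  shows "(node_wt \<theta> * (max 0 (x - \<theta>))\<^sup>2 + left_wt \<theta> * x\<^sup>2) / 2 - x ^ 3 / 6 \<le> 0"
proof (cases "x \<le> \<theta>")
  case True
  have "left_wt \<theta> * x\<^sup>2 \<le> 0" "0 \<le> x ^ 3"
    using cell_wt_bounds(2)[OF \<theta>] x by (auto simp: mult_nonpos_nonneg)
  then have "left_wt \<theta> * x\<^sup>2 / 2 - x ^ 3 / 6 \<le> 0"
    by linarith
  then show ?thesis
    using True by simp
next
  case False
  have mom: "node_wt \<theta> + left_wt \<theta> = 1 - right_wt \<theta>" "node_wt \<theta> * \<theta> = 1 / 2 - right_wt \<theta>"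
    "node_wt \<theta> * \<theta>\<^sup>2 = 1 / 3 - right_wt \<theta>"
    using cell_wt_moments(1-3)[of \<theta>] \<theta> by simp_all
  have "node_wt \<theta> * (x - \<theta>)\<^sup>2 + left_wt \<theta> * x\<^sup>2
      = (node_wt \<theta> + left_wt \<theta>) * x\<^sup>2 - 2 * (node_wt \<theta> * \<theta>) * x + node_wt \<theta> * \<theta>\<^sup>2"
    by (simp add: power2_eq_square algebra_simps)
  \<comment> \<open>Seen from the right end: exactness lets the kernel on [\<theta>, 1] be rewritten
    with the weight at 1 alone, which exposes the factor (1 - x)^2.\<close>
  then have "(node_wt \<theta> * (x - \<theta>)\<^sup>2 + left_wt \<theta> * x\<^sup>2) / 2 - x ^ 3 / 6
      = (1 - x)\<^sup>2 * ((1 - x) - 3 * right_wt \<theta>) / 6"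
    unfolding mom by (simp add: power2_eq_square power3_eq_cube field_simps)
  \<comment> \<open>The difference 3 * right_wt \<theta> - (1 - \<theta>) equals \<theta> (1 - 2
    \<theta>) / (2 (1 - \<theta>)), which is nonnegative, and 1 - x < 1 - \<theta>.\<close>
  moreover have "1 - x \<le> 3 * right_wt \<theta>"
  proof -
    have "(1 - \<theta>) * (2 * (1 - \<theta>)) \<le> 2 - 3 * \<theta>"
      using mult_nonneg_nonneg[of \<theta> "1 - 2 * \<theta>"] \<theta> by (simp add: algebra_simps)
    moreover have "3 * right_wt \<theta> = (2 - 3 * \<theta>) / (2 * (1 - \<theta>))"
      using \<theta> by (simp add: right_wt_def divide_simps) (simp add: algebra_simps)
    moreover have "0 < 2 * (1 - \<theta>)"
      using \<theta> by simp
    ultimately have "1 - \<theta> \<le> 3 * right_wt \<theta>"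
      by (metis pos_le_divide_eq)
    then show ?thesis
      using False by simp
  qed
  then have "(1 - x)\<^sup>2 * ((1 - x) - 3 * right_wt \<theta>) / 6 \<le> 0"
    by (simp add: mult_nonneg_nonpos)
  moreover have "max 0 (x - \<theta>) = x - \<theta>"
    using False by simp
  ultimately show ?thesis
    by metis
qed

lemma cell_rem_nonpos:
  assumes \<theta>: "1 / 5 \<le> \<theta>" "\<theta> \<le> 1 / 3" and g: "C2_derivs g g1 g2"
    and mono: "\<And>x y. \<lbrakk>0 \<le> x; x \<le> y; y \<le> 1\<rbrakk> \<Longrightarrow> g2 x \<le> g2 y"
  shows "cell_rem \<theta> g \<le> 0"
proof -
  have "\<exists>x\<in>{0..1}. 1 * integral {0..1} g - point_sum [(node_wt \<theta>, \<theta>), (left_wt \<theta>, 0), (right_wt \<theta>, 1)] g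
      = (g2 1 - g2 0) * (point_sum [(node_wt \<theta>, \<theta>), (left_wt \<theta>, 0), (right_wt \<theta>, 1)]
          (\<lambda>m. (max 0 (x - m))\<^sup>2) / 2 - 1 * x ^ 3 / 6)"
    by (rule peano_mean_value[OF g mono]) (use cell_wt_moments[of \<theta>] \<theta> in auto)
  then obtain x where "x \<in> {0..1}" and "cell_rem \<theta> g = (g2 1 - g2 0) *
      ((node_wt \<theta> * (max 0 (x - \<theta>))\<^sup>2 + left_wt \<theta> * x\<^sup>2) / 2 - x ^ 3 / 6)"
    by (auto simp: cell_rem_def algebra_simps)
  then show ?thesis
    using cell_kernel_nonpos[OF \<theta>, of x] mono[of 0 1] by (simp add: mult_nonneg_nonpos)
qed

lemma cell_rem_diff_cubic:
  assumes "0 < \<theta>" "\<theta> < 1" and g: "continuous_on {0..1} g"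
  shows "cell_rem \<theta> (\<lambda>x. c * g x - k * x ^ 3 / 6) = c * cell_rem \<theta> g + k * ((1 - 2 * \<theta>) / 72)"
proof -
  have "((\<lambda>x. x ^ 3 / 6) has_integral (1 ^ 4 / 24 - 0 ^ 4 / 24)) {0..1::real}"
    by (intro fundamental_theorem_of_calculus)
      (auto intro!: derivative_eq_intros simp flip: has_real_derivative_iff_has_vector_derivative)
  then have cubic: "((\<lambda>x. x ^ 3 / 6) has_integral 1 / 24) {0..1::real}"
    by simp
  have "(g has_integral integral {0..1} g) {0..1}"
    using g by (simp add: integrable_continuous_interval integrable_integral)
  then have "((\<lambda>x. c * g x - k * (x ^ 3 / 6)) has_integral c * integral {0..1} g - k * (1 / 24)) {0..1}"
    by (intro has_integral_diff has_integral_mult_right cubic)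
  then have "integral {0..1} (\<lambda>x. c * g x - k * x ^ 3 / 6) = c * integral {0..1} g - k * (1 / 24)"
    by (simp add: integral_unique)
  then have "cell_rem \<theta> (\<lambda>x. c * g x - k * x ^ 3 / 6)
      = c * cell_rem \<theta> g - k / 24 + k / 6 * (node_wt \<theta> * \<theta> ^ 3 + right_wt \<theta>)"
    by (simp add: cell_rem_def algebra_simps)
  then show ?thesis
    unfolding cell_wt_moments(4)[OF assms(1,2)] by (simp add: field_simps)
qed

text \<open>If l and u are the extreme values of \<open>g3\<close>, then g - l x^3/6 and u x^3/6 - g
  have nondecreasing second derivatives. Nonpositivity of their remainders bounds a quotient by l
  and u, and \<open>g3\<close> attains every value in between.\<close>

lemma cell_rem_mean_value:
  assumes \<theta>: "1 / 5 \<le> \<theta>" "\<theta> \<le> 1 / 3" and g: "C2_derivs g g1 g2"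
    and g3: "\<And>x. x \<in> {0..1} \<Longrightarrow> (g2 has_real_derivative g3 x) (at x within {0..1})"
    and cont: "continuous_on {0..1} g3"
  shows "\<exists>\<xi>\<in>{0..1}. cell_rem \<theta> g = - ((1 - 2 * \<theta>) / 72) * g3 \<xi>"
proof -
  obtain l u where img: "g3 ` {0..1} = {l..u}"
    using continuous_image_closed_interval[OF _ cont] by auto
  have le: "c * g2 x - k * x \<le> c * g2 y - k * y"
    if "0 \<le> x" "x \<le> y" "y \<le> 1" and nonneg: "\<And>t. t \<in> {0..1} \<Longrightarrow> 0 \<le> c * g3 t - k" for c k x y
  proof (rule DERIV_nonneg_imp_increasing_open[OF \<open>x \<le> y\<close>])
    show "\<exists>z. ((\<lambda>x. c * g2 x - k * x) has_real_derivative z) (at t) \<and> 0 \<le> z" if t: "x < t" "t < y" for t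
    proof -
      have "(g2 has_real_derivative g3 t) (at t within {0..1})"
        using g3 t that(1,2) \<open>0 \<le> x\<close> \<open>y \<le> 1\<close> by simp
      moreover have "at t within {0..1} = at t"
        using t \<open>0 \<le> x\<close> \<open>y \<le> 1\<close> by (intro at_within_interior) auto
      ultimately have "(g2 has_real_derivative g3 t) (at t)"
        by simp
      then have "((\<lambda>x. c * g2 x - k * x) has_real_derivative c * g3 t - k) (at t)"
        by (auto intro!: derivative_eq_intros)
      then show ?thesis
        using nonneg[of t] t \<open>0 \<le> x\<close> \<open>y \<le> 1\<close> by auto
    qed
    have "continuous_on {x..y} g2"
      using C2_derivs_continuous(3)[OF g] by (rule continuous_on_subset) (use that in auto)
    then show "continuous_on {x..y} (\<lambda>x. c * g2 x - k * x)"
      by (intro continuous_intros)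
  qed
  have rem: "c * cell_rem \<theta> g + k * ((1 - 2 * \<theta>) / 72) \<le> 0"
    if "\<And>t. t \<in> {0..1} \<Longrightarrow> 0 \<le> c * g3 t - k" for c k
  proof -
    have "cell_rem \<theta> (\<lambda>x. c * g x - k * x ^ 3 / 6) \<le> 0"
      by (rule cell_rem_nonpos[OF \<theta> C2_derivs_diff_cubic[OF g]]) (rule le[OF _ _ _ that])
    then show ?thesis
      using cell_rem_diff_cubic[of \<theta> g c k] \<theta> C2_derivs_continuous(1)[OF g] by simp
  qed
  define \<kappa> where "\<kappa> = (1 - 2 * \<theta>) / 72"
  have "\<kappa> > 0"
    using \<theta> by (simp add: \<kappa>_def)
  have lu: "l \<le> g3 t" "g3 t \<le> u" if "t \<in> {0..1}" for t
    using img that by (metis atLeastAtMost_iff image_eqI)+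
  have "cell_rem \<theta> g + l * \<kappa> \<le> 0"
    using rem[of 1 l] lu by (simp add: \<kappa>_def)
  moreover have "- cell_rem \<theta> g - u * \<kappa> \<le> 0"
    using rem[of "- 1" "- u"] lu by (simp add: \<kappa>_def)
  ultimately have "- cell_rem \<theta> g / \<kappa> \<in> g3 ` {0..1}"
    unfolding img using \<open>\<kappa> > 0\<close> by (simp add: field_simps)
  then obtain \<xi> where "\<xi> \<in> {0..1}" "g3 \<xi> = - cell_rem \<theta> g / \<kappa>"
    by auto
  then show ?thesis
    using \<open>\<kappa> > 0\<close> by (intro bexI[of _ \<xi>]) (auto simp flip: \<kappa>_def)
qed

section \<open>Comparison of a cell with its two halves\<close>

lemma concave_quadratic_nonneg:
  fixes p q r :: real
  assumes "p \<le> 0" "x \<le> s" "s \<le> y"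
    and "0 \<le> p * x\<^sup>2 + q * x + r" "0 \<le> p * y\<^sup>2 + q * y + r"
  shows "0 \<le> p * s\<^sup>2 + q * s + r"
proof (cases "x = y")
  case True
  then show ?thesis
    using assms by auto
next
  case False
  \<comment> \<open>The chord through the end values plus the concavity defect, everything
    multiplied by y - x.\<close>
  have "(p * s\<^sup>2 + q * s + r) * (y - x)
      = (y - s) * (p * x\<^sup>2 + q * x + r) + (s - x) * (p * y\<^sup>2 + q * y + r)
        + (- p) * ((s - x) * (y - s) * (y - x))"
    by algebra
  moreover have "0 \<le> (y - s) * (p * x\<^sup>2 + q * x + r)" "0 \<le> (s - x) * (p * y\<^sup>2 + q * y + r)"
    using assms by simp_all
  moreover have "0 \<le> (- p) * ((s - x) * (y - s) * (y - x))"
    using assms by (intro mult_nonneg_nonneg) auto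
  ultimately have "0 \<le> (p * s\<^sup>2 + q * s + r) * (y - x)"
    by linarith
  then show ?thesis
    using False assms by (simp add: zero_le_mult_iff)
qed

text \<open>
  The kernel of the difference between a cell rule and its two half-cell rules. It is piecewise
  quadratic: a sum of nonnegative terms to the left of \<open>\<theta>\<close> and to the right of the last interior
  node, and concave in between.
\<close>

lemma refinement_kernel_nonneg:
  assumes \<theta>: "1 / 5 \<le> \<theta>" "\<theta> \<le> 1 / 3" and \<phi>: "1 / 5 \<le> \<phi>" "\<phi> \<le> 1 / 3" and \<psi>: "1 / 5 \<le> \<psi>" "\<psi> \<le> 1 / 3"
    and left: "2 * left_wt \<theta> \<le> left_wt \<phi>" and joint: "right_wt \<phi> = - left_wt \<psi>"
    and x: "0 \<le> x" "x \<le> 1"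
  shows "0 \<le> (left_wt \<phi> / 2 - left_wt \<theta>) * x\<^sup>2 + node_wt \<phi> / 2 * (max 0 (x - \<phi> / 2))\<^sup>2
      + node_wt \<psi> / 2 * (max 0 (x - (1 / 2 + \<psi> / 2)))\<^sup>2 - node_wt \<theta> * (max 0 (x - \<theta>))\<^sup>2"
proof -
  \<comment> \<open>On the middle piece, between \<theta> and the node 1/2 + \<psi>/2, the kernel is
    p x^2 + q x + r.\<close>
  define p where "p = left_wt \<phi> / 2 - left_wt \<theta> + node_wt \<phi> / 2 - node_wt \<theta>"
  define q where "q = 2 * node_wt \<theta> * \<theta> - node_wt \<phi> * \<phi> / 2"
  define r where "r = node_wt \<phi> * \<phi>\<^sup>2 / 8 - node_wt \<theta> * \<theta>\<^sup>2"
  note mom\<theta> = cell_wt_moments(1-3)[of \<theta>] and mom\<phi> = cell_wt_moments(1-3)[of \<phi>]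
    and mom\<psi> = cell_wt_moments(1-3)[of \<psi>]
  note bd = cell_wt_bounds[OF \<theta>] cell_wt_bounds[OF \<phi>] cell_wt_bounds[OF \<psi>]
  have mid: "(left_wt \<phi> / 2 - left_wt \<theta>) * t\<^sup>2 + node_wt \<phi> / 2 * (t - \<phi> / 2)\<^sup>2 - node_wt \<theta> * (t - \<theta>)\<^sup>2
      = p * t\<^sup>2 + q * t + r" for t
    unfolding p_def q_def r_def by (simp add: power2_eq_square field_simps)
  \<comment> \<open>To the right of the last interior node the kernel is given by the weight at 1
    alone. Here \<open>joint\<close> enters: it is the reason why no term for the node 1/2
    occurs.\<close>
  have right: "p * t\<^sup>2 + q * t + r + node_wt \<psi> / 2 * (t - (1 / 2 + \<psi> / 2))\<^sup>2
      = (right_wt \<theta> - right_wt \<psi> / 2) * (1 - t)\<^sup>2" for t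
  proof -
    have \<phi>w: "node_wt \<phi> = 1 - left_wt \<phi> - right_wt \<phi>" "node_wt \<phi> * \<phi> = 1 / 2 - right_wt \<phi>"
        "node_wt \<phi> * \<phi>\<^sup>2 = 1 / 3 - right_wt \<phi>"
      using mom\<phi> \<phi> by simp_all
    have \<theta>w: "node_wt \<theta> = 1 - left_wt \<theta> - right_wt \<theta>" "node_wt \<theta> * \<theta> = 1 / 2 - right_wt \<theta>"
        "node_wt \<theta> * \<theta>\<^sup>2 = 1 / 3 - right_wt \<theta>"
      using mom\<theta> \<theta> by simp_all
    have \<psi>w: "node_wt \<psi> = 1 + right_wt \<phi> - right_wt \<psi>" "node_wt \<psi> * \<psi> = 1 / 2 - right_wt \<psi>"
        "node_wt \<psi> * \<psi>\<^sup>2 = 1 / 3 - right_wt \<psi>"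
      using mom\<psi> \<psi> joint by simp_all
    have e1: "p = right_wt \<theta> - 1 / 2 - right_wt \<phi> / 2"
      unfolding p_def \<phi>w(1) \<theta>w(1) by (simp add: field_simps)
    have e2: "q = 3 / 4 - 2 * right_wt \<theta> + right_wt \<phi> / 2"
      unfolding q_def mult.assoc \<phi>w(2) \<theta>w(2) by (simp add: field_simps)
    have e3: "r = right_wt \<theta> - right_wt \<phi> / 8 - 7 / 24"
      unfolding r_def \<phi>w(3) \<theta>w(3) by (simp add: field_simps)
    have "node_wt \<psi> / 2 * (t - (1 / 2 + \<psi> / 2))\<^sup>2
        = node_wt \<psi> * (t - 1 / 2)\<^sup>2 / 2 - (node_wt \<psi> * \<psi>) * (t - 1 / 2) / 2 + (node_wt \<psi> * \<psi>\<^sup>2) / 8"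
      by (simp add: power2_eq_square field_simps)
    also have "\<dots> = (1 + right_wt \<phi> - right_wt \<psi>) * (t - 1 / 2)\<^sup>2 / 2
        - (1 / 2 - right_wt \<psi>) * (t - 1 / 2) / 2 + (1 / 3 - right_wt \<psi>) / 8"
      unfolding \<psi>w(2,3) unfolding \<psi>w(1) ..
    finally show ?thesis
      unfolding e1 e2 e3 by (simp add: power2_eq_square field_simps)
  qed
  \<comment> \<open>The moments turn p into right_wt \<theta> - 1/2 - right_wt \<phi> / 2, which is
    at most 7/24 - 1/2 - 1/8.\<close>
  have p: "p \<le> 0"
    using right[of 0] bd mom\<theta> mom\<phi> \<theta> \<phi> unfolding p_def by linarith
  have at_left: "0 \<le> p * \<theta>\<^sup>2 + q * \<theta> + r"
    using bd left \<phi> \<theta> unfolding mid[symmetric] by simp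
  \<comment> \<open>At this node the square in \<open>right\<close> vanishes, and right_wt \<theta>
    >= 1/4 exceeds right_wt \<psi> / 2 <= 7/48.\<close>
  have at_right: "0 \<le> p * (1 / 2 + \<psi> / 2)\<^sup>2 + q * (1 / 2 + \<psi> / 2) + r"
    using right[of "1 / 2 + \<psi> / 2"] bd by simp
  \<comment> \<open>The bounds fix the order of the nodes: \<phi>/2 <= 1/6 < 1/5 <= \<theta> <= 1/3
    < 1/2 + \<psi>/2.\<close>
  consider "x \<le> \<theta>" | "\<theta> \<le> x" "x \<le> 1 / 2 + \<psi> / 2" | "1 / 2 + \<psi> / 2 \<le> x"
    by linarith
  then show ?thesis
  proof cases
    case 1
    then have "max 0 (x - (1 / 2 + \<psi> / 2)) = 0" "max 0 (x - \<theta>) = 0"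
      using \<theta> \<psi> by auto
    then show ?thesis
      using bd left by simp
  next
    case 2
    then have "max 0 (x - (1 / 2 + \<psi> / 2)) = 0" "max 0 (x - \<theta>) = x - \<theta>" "max 0 (x - \<phi> / 2) = x - \<phi> / 2"
      using \<theta> \<phi> by auto
    then show ?thesis
      using concave_quadratic_nonneg[OF p 2 at_left at_right] mid[of x] by simp
  next
    case 3
    then have "max 0 (x - (1 / 2 + \<psi> / 2)) = x - (1 / 2 + \<psi> / 2)" "max 0 (x - \<theta>) = x - \<theta>"
        "max 0 (x - \<phi> / 2) = x - \<phi> / 2"
      using \<theta> \<phi> \<psi> by auto
    moreover have "0 \<le> (right_wt \<theta> - right_wt \<psi> / 2) * (1 - x)\<^sup>2"
      using bd by simp
    ultimately show ?thesis
      using mid[of x] right[of x] by simp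
  qed
qed

lemma integral_affine_unit:
  fixes g :: "real \<Rightarrow> real"
  assumes "0 < h" "continuous_on {a..a + h} g"
  shows "integral {0..1} (\<lambda>s. g (a + h * s)) = integral {a..a + h} g / h"
proof -
  have "(g has_integral integral {a..a + h} g) (cbox a (a + h))"
    using assms by (simp add: integrable_continuous_interval integrable_integral)
  from has_integral_affinity'[OF this \<open>0 < h\<close>, of a]
  have "((\<lambda>s. g (a + h * s)) has_integral integral {a..a + h} g / h) {0..1}"
    using \<open>0 < h\<close> by (simp add: add.commute divide_inverse mult.commute)
  then show ?thesis
    by (rule integral_unique)
qed

lemma cell_rem_refine:
  assumes \<theta>: "1 / 5 \<le> \<theta>" "\<theta> \<le> 1 / 3" and \<phi>: "1 / 5 \<le> \<phi>" "\<phi> \<le> 1 / 3" and \<psi>: "1 / 5 \<le> \<psi>" "\<psi> \<le> 1 / 3"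
    and left: "2 * left_wt \<theta> \<le> left_wt \<phi>" and joint: "right_wt \<phi> = - left_wt \<psi>"
    and g: "C2_derivs g g1 g2"
    and mono: "\<And>x y. \<lbrakk>0 \<le> x; x \<le> y; y \<le> 1\<rbrakk> \<Longrightarrow> g2 x \<le> g2 y"
  shows "2 * cell_rem \<theta> g \<le> cell_rem \<phi> (\<lambda>s. g (s / 2)) + cell_rem \<psi> (\<lambda>s. g (1 / 2 + s / 2))"
proof -
  \<comment> \<open>The average of the two half-cell rules minus the cell rule. The node 1/2 is
    absent because its weight (right_wt \<phi> + left_wt \<psi>) / 2 is zero by
    \<open>joint\<close>.\<close>
  let ?ws = "[(left_wt \<phi> / 2 - left_wt \<theta>, 0), (node_wt \<phi> / 2, \<phi> / 2), (node_wt \<psi> / 2, 1 / 2 + \<psi> / 2),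
      (- node_wt \<theta>, \<theta>), (right_wt \<psi> / 2 - right_wt \<theta>, 1)]"
  have pos: "0 < \<theta>" "\<theta> < 1" "0 < \<phi>" "\<phi> < 1" "0 < \<psi>" "\<psi> < 1"
    using \<theta> \<phi> \<psi> by auto
  note mom = cell_wt_moments(1-3)[OF pos(1,2)] cell_wt_moments(1-3)[OF pos(3,4)]
    cell_wt_moments(1-3)[OF pos(5,6)]
  have cont: "continuous_on {0..1} g"
    by (rule C2_derivs_continuous(1)[OF g])
  have "integral {0..1} (\<lambda>s. g (0 + 1 / 2 * s)) = integral {0..0 + 1 / 2} g / (1 / 2)"
    by (intro integral_affine_unit continuous_on_subset[OF cont]) auto
  moreover have "integral {0..1} (\<lambda>s. g (1 / 2 + 1 / 2 * s)) = integral {1 / 2..1 / 2 + 1 / 2} g / (1 / 2)"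
    by (intro integral_affine_unit continuous_on_subset[OF cont]) auto
  moreover have "integral {0..1 / 2} g + integral {1 / 2..1} g = integral {0..1} g"
    by (intro Henstock_Kurzweil_Integration.integral_combine integrable_continuous_interval cont) auto
  ultimately have "integral {0..1} (\<lambda>s. g (s / 2)) + integral {0..1} (\<lambda>s. g (1 / 2 + s / 2)) = 2 * integral {0..1} g"
    by simp
  then have eq: "cell_rem \<phi> (\<lambda>s. g (s / 2)) + cell_rem \<psi> (\<lambda>s. g (1 / 2 + s / 2)) - 2 * cell_rem \<theta> g
      = 2 * (0 * integral {0..1} g - point_sum ?ws g)"
    unfolding cell_rem_def using joint by (simp add: algebra_simps)
  \<comment> \<open>The integrals cancel, so the mean value is applied to a purely discrete
    functional, with total mass c = 0.\<close>
  have "\<exists>x\<in>{0..1}. 0 * integral {0..1} g - point_sum ?ws g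
      = (g2 1 - g2 0) * (point_sum ?ws (\<lambda>m. (max 0 (x - m))\<^sup>2) / 2 - 0 * x ^ 3 / 6)"
  proof (rule peano_mean_value[OF g mono])
    show "point_sum ?ws (\<lambda>m. 1) = 0"
      using mom joint by (simp add: field_simps)
    have "node_wt \<psi> / 2 * (1 / 2 + \<psi> / 2) = node_wt \<psi> / 4 + node_wt \<psi> * \<psi> / 4"
      by (simp add: field_simps)
    then show "point_sum ?ws (\<lambda>m. m) = 0 / 2"
      using mom joint by (simp add: algebra_simps)
    have "node_wt \<psi> / 2 * (1 / 2 + \<psi> / 2)\<^sup>2 = node_wt \<psi> / 8 + node_wt \<psi> * \<psi> / 4 + node_wt \<psi> * \<psi>\<^sup>2 / 8"
      "node_wt \<phi> / 2 * (\<phi> / 2)\<^sup>2 = node_wt \<phi> * \<phi>\<^sup>2 / 8"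
      by (simp_all add: power2_eq_square algebra_simps add_divide_distrib)
    then show "point_sum ?ws power2 = 0 / 3"
    proof -
      have sq: "node_wt \<theta> * \<theta>\<^sup>2 = 1 / 3 - right_wt \<theta>" "node_wt \<phi> * \<phi>\<^sup>2 = 1 / 3 + left_wt \<psi>"
        "node_wt \<psi> * \<psi>\<^sup>2 = 1 / 3 - right_wt \<psi>" "node_wt \<psi> * \<psi> = 1 / 2 - right_wt \<psi>"
        and n: "node_wt \<psi> = 1 - left_wt \<psi> - right_wt \<psi>"
        using mom joint by simp_all
      from \<open>node_wt \<psi> / 2 * (1 / 2 + \<psi> / 2)\<^sup>2 = _\<close> \<open>node_wt \<phi> / 2 * (\<phi> / 2)\<^sup>2 = _\<close>
      have "point_sum ?ws power2 = node_wt \<phi> * \<phi>\<^sup>2 / 8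
          + (node_wt \<psi> / 8 + node_wt \<psi> * \<psi> / 4 + node_wt \<psi> * \<psi>\<^sup>2 / 8)
          - node_wt \<theta> * \<theta>\<^sup>2 + right_wt \<psi> / 2 - right_wt \<theta>"
        unfolding point_sum.simps by (simp only:) simp
      also have "\<dots> = 0 / 3"
        unfolding sq unfolding n by (simp add: field_simps)
      finally show ?thesis .
    qed
  qed (use \<theta> \<phi> \<psi> in auto)
  then obtain x where x: "x \<in> {0..1}" and pv: "0 * integral {0..1} g - point_sum ?ws g
      = (g2 1 - g2 0) * (point_sum ?ws (\<lambda>m. (max 0 (x - m))\<^sup>2) / 2 - 0 * x ^ 3 / 6)"
    by blast
  have "0 \<le> point_sum ?ws (\<lambda>m. (max 0 (x - m))\<^sup>2)"
    using refinement_kernel_nonneg[OF \<theta> \<phi> \<psi> left joint, of x] x by simp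
  then have "0 \<le> 0 * integral {0..1} g - point_sum ?ws g"
    unfolding pv using mono[of 0 1] by simp
  then show ?thesis
    using eq by simp
qed

section \<open>The right Radau formula\<close>

primrec radau_theta :: "nat \<Rightarrow> real" where
  "radau_theta 0 = 1 / 3"
| "radau_theta (Suc k) = (1 - radau_theta k) / (5 - 6 * radau_theta k)"

text \<open>The recursion map is increasing on [1/5, 1/3] with image [4/19, 2/9], so the interval is
  invariant.\<close>

lemma radau_theta_bounds: "1 / 5 \<le> radau_theta k \<and> radau_theta k \<le> 1 / 3"
proof (induction k)
  case (Suc k)
  then show ?case
    by (auto simp: divide_simps)
qed simp

lemma radau_theta_in_unit: "0 < radau_theta k" "radau_theta k < 1"
  using radau_theta_bounds[of k] by auto

lemma radau_theta_Suc_le: "radau_theta (Suc k) \<le> 2 / 9"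
  using radau_theta_bounds[of k] by (auto simp: divide_simps)

lemma left_wt_third [simp]: "left_wt (1 / 3) = 0"
  by (simp add: left_wt_def)

lemma left_wt_theta_Suc: "left_wt (radau_theta (Suc k)) = - right_wt (radau_theta k)"
proof -
  define t where "t = radau_theta k"
  have t: "1 - t \<noteq> 0" "5 - 6 * t \<noteq> 0" "1 / 5 \<le> t" "t \<le> 1 / 3"
    using radau_theta_bounds[of k] by (auto simp: t_def)
  have "left_wt (radau_theta (Suc k)) = (3 * ((1 - t) / (5 - 6 * t)) - 1) / (6 * ((1 - t) / (5 - 6 * t)))"
    by (simp add: left_wt_def t_def)
  also have "\<dots> = (3 * (1 - t) - (5 - 6 * t)) / (6 * (1 - t))"
    using t by (simp add: divide_simps)
  also have "\<dots> = - right_wt t"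
    by (simp add: right_wt_def minus_divide_left)
  finally show ?thesis
    by (simp add: t_def)
qed

text \<open>Makes the coefficient of x^2 at the left end of the refinement kernel nonnegative. For k
  = 0 both sides vanish. For k > 0 the left side is at most -1/2, since \<theta> <= 2/9 from the
  second cell on, and the right side is at least -1/3.\<close>

lemma left_wt_theta_double: "2 * left_wt (radau_theta k) \<le> left_wt (radau_theta (2 * k))"
proof (cases k)
  case (Suc j)
  have "left_wt (radau_theta k) \<le> - 1 / 4"
    using radau_theta_Suc_le[of j] radau_theta_bounds[of k] Suc
    by (simp add: left_wt_def divide_simps del: radau_theta.simps)
  then show ?thesis
    using cell_wt_bounds(3)[of "radau_theta (2 * k)"] radau_theta_bounds[of "2 * k"] by simp
qed simp

text \<open>
  The weight at \<open>1\<close> equals \<open>right_wt (radau_theta (n - 1)) / n\<close> by \<open>left_wt_theta_Suc\<close>; in the form below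
  the cell rules telescope without a case distinction.
\<close>

definition radau_sum :: "nat \<Rightarrow> (real \<Rightarrow> real) \<Rightarrow> real" where
  "radau_sum n f = (\<Sum>k<n. node_wt (radau_theta k) / real n * f ((real k + radau_theta k) / real n))
     - left_wt (radau_theta n) / real n * f 1"

lemma cell_subset_unit:
  assumes "k < n" "s \<in> {0..1}"
  shows "real k / real n + 1 / real n * s \<in> {0..1}"
proof -
  have "real k + 1 \<le> real n"
    using \<open>k < n\<close> by simp
  then have "real k + s \<le> real n"
    using assms(2) by simp
  then have "(real k + s) / real n \<le> 1" "0 \<le> (real k + s) / real n"
    using assms by auto
  then show ?thesis
    by (simp add: add_divide_distrib)
qed

lemma remainder_radau_sum:
  assumes "0 < n" and f: "continuous_on {0..1} f"
  shows "remainder (radau_sum n) f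
    = (\<Sum>k<n. cell_rem (radau_theta k) (\<lambda>s. f (real k / real n + 1 / real n * s))) / real n"
proof -
  \<comment> \<open>The boundary term is the weight at m/n that cell m will cancel. It vanishes for
    m = 0, as left_wt (1/3) = 0, and for m = n it becomes the term of \<open>radau_sum\<close> at
    1.\<close>
  have sums: "(\<Sum>k<m. cell_rem (radau_theta k) (\<lambda>s. f (real k / real n + 1 / real n * s))) / real n
      = integral {0..real m / real n} f
        - (\<Sum>k<m. node_wt (radau_theta k) / real n * f ((real k + radau_theta k) / real n))
        + left_wt (radau_theta m) / real n * f (real m / real n)" if "m \<le> n" for m
    using that
  proof (induction m)
    case (Suc m)
    have le: "real m / real n + 1 / real n \<le> 1"
      using Suc.prems \<open>0 < n\<close> by (simp flip: add_divide_distrib of_nat_Suc add: field_simps)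
    have eq: "real m / real n + 1 / real n = real (Suc m) / real n"
      by (simp add: add_divide_distrib)
    have cont: "continuous_on {u..v} f" if "0 \<le> u" "v \<le> 1" for u v
      using that by (intro continuous_on_subset[OF f]) auto
    have "integral {0..1} (\<lambda>s. f (real m / real n + 1 / real n * s))
        = integral {real m / real n..real m / real n + 1 / real n} f / (1 / real n)"
      using \<open>0 < n\<close> le by (intro integral_affine_unit cont) auto
    then have "integral {0..1} (\<lambda>s. f (real m / real n + 1 / real n * s)) / real n
        = integral {real m / real n..real (Suc m) / real n} f"
      unfolding eq using \<open>0 < n\<close> by simp
    moreover have "integral {0..real m / real n} f + integral {real m / real n..real (Suc m) / real n} f
        = integral {0..real (Suc m) / real n} f"
      using le eq by (intro Henstock_Kurzweil_Integration.integral_combine integrable_continuous_interval cont)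
        (auto simp: divide_right_mono)
    moreover have at: "real m / real n + 1 / real n * radau_theta m = (real m + radau_theta m) / real n"
        "real m / real n + 1 / real n * 0 = real m / real n" "real m / real n + 1 / real n * 1 = real (Suc m) / real n"
      by (simp_all add: add_divide_distrib)
    ultimately have "cell_rem (radau_theta m) (\<lambda>s. f (real m / real n + 1 / real n * s)) / real n
      = integral {0..real (Suc m) / real n} f - integral {0..real m / real n} f
        - node_wt (radau_theta m) / real n * f ((real m + radau_theta m) / real n)
        - left_wt (radau_theta m) / real n * f (real m / real n)
        - right_wt (radau_theta m) / real n * f (real (Suc m) / real n)"
      unfolding cell_rem_def at by (simp add: diff_divide_distrib add_divide_distrib del: of_nat_Suc)
    with Suc show ?case
      by (simp add: left_wt_theta_Suc add_divide_distrib del: radau_theta.simps of_nat_Suc)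
  qed simp
  show ?thesis
    using sums[of n] \<open>0 < n\<close> by (simp add: remainder_def radau_sum_def)
qed

lemma cell_rem_quadratic:
  assumes \<theta>: "0 < \<theta>" "\<theta> < 1" and g: "\<And>s. s \<in> {0..1} \<Longrightarrow> g s = a + b * s + c * s\<^sup>2"
  shows "cell_rem \<theta> g = 0"
proof -
  have "((\<lambda>s. a + b * s + c * s\<^sup>2) has_integral
      (a * 1 + b * 1\<^sup>2 / 2 + c * 1 ^ 3 / 3) - (a * 0 + b * 0\<^sup>2 / 2 + c * 0 ^ 3 / 3)) {0..1}"
    by (intro fundamental_theorem_of_calculus)
      (auto intro!: derivative_eq_intros simp flip: has_real_derivative_iff_has_vector_derivative)
  then have "(g has_integral a + b / 2 + c / 3) {0..1}"
    using has_integral_eq[of "{0..1}" "\<lambda>s. a + b * s + c * s\<^sup>2" g] g by simp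
  then have int: "integral {0..1} g = a + b / 2 + c / 3"
    by (rule integral_unique)
  have "node_wt \<theta> * g \<theta> + left_wt \<theta> * g 0 + right_wt \<theta> * g 1
      = a * (node_wt \<theta> + left_wt \<theta> + right_wt \<theta>) + b * (node_wt \<theta> * \<theta> + right_wt \<theta>)
        + c * (node_wt \<theta> * \<theta>\<^sup>2 + right_wt \<theta>)"
    using g[of \<theta>] g[of 0] g[of 1] \<theta> by (simp add: algebra_simps)
  then show ?thesis
    unfolding cell_rem_def int cell_wt_moments(1-3)[OF \<theta>] by simp
qed

lemma remainder_radau_sum_spline:
  assumes "0 < n" and f: "f \<in> quadratic_splines n"
  shows "remainder (radau_sum n) f = 0"
proof -
  have cont: "continuous_on {0..1} f"
    using f by (simp add: quadratic_splines_def)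
  have "cell_rem (radau_theta k) (\<lambda>s. f (real k / real n + 1 / real n * s)) = 0" if "k < n" for k
  proof -
    obtain p :: "real poly" where deg: "degree p \<le> 2"
      and p: "\<And>x. x \<in> {real k / real n <..< real (Suc k) / real n} \<Longrightarrow> f x = poly p x"
      using f \<open>k < n\<close> unfolding quadratic_splines_def by blast
    have lt: "real k / real n < real (Suc k) / real n"
      using \<open>0 < n\<close> by (simp add: divide_strict_right_mono)
    have "real (Suc k) / real n \<le> 1"
      using \<open>k < n\<close> by simp
    then have "{real k / real n .. real (Suc k) / real n} \<subseteq> {0..1}"
      by simp
    then have "continuous_on {real k / real n .. real (Suc k) / real n} (\<lambda>x. f x - poly p x)"
      by (intro continuous_intros continuous_on_subset[OF cont])
    \<comment> \<open>Splines are given as polynomials on open cells only, while the cell rule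
      evaluates at the knots; continuity closes the gap.\<close>
    then have "continuous_on (closure {real k / real n <..< real (Suc k) / real n}) (\<lambda>x. f x - poly p x)"
      using lt by simp
    then have closed: "f x = poly p x" if "x \<in> {real k / real n .. real (Suc k) / real n}" for x
      using continuous_constant_on_closure[of "{real k / real n <..< real (Suc k) / real n}" "\<lambda>x. f x - poly p x" 0 x] p lt that by simp
    obtain c0 c1 c2 where "p = [:c0, c1, c2:]"
    proof
      show "p = [:coeff p 0, coeff p 1, coeff p 2:]"
        using deg by (intro poly_eqI) (auto simp: coeff_pCons coeff_eq_0 numeral_2_eq_2 split: nat.split)
    qed
    have "f (real k / real n + 1 / real n * s)
        = poly p (real k / real n) + ((c1 + 2 * c2 * (real k / real n)) / real n) * s + (c2 / (real n)\<^sup>2) * s\<^sup>2"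
      if "s \<in> {0..1}" for s
    proof -
      have "real k / real n + 1 / real n * s \<in> {real k / real n .. real (Suc k) / real n}"
        using that \<open>0 < n\<close> by (auto simp: field_simps)
      then show ?thesis
        by (simp add: closed \<open>p = _\<close> power2_eq_square algebra_simps add_divide_distrib)
    qed
    then show ?thesis
      by (intro cell_rem_quadratic radau_theta_in_unit)
  qed
  then show ?thesis
    using remainder_radau_sum[OF \<open>0 < n\<close> cont] by simp
qed

lemma is_right_radau_radau_sum:
  assumes "0 < n"
  shows "is_right_radau n (radau_sum n)"
  unfolding is_right_radau_def
proof (intro conjI exI)
  let ?\<tau> = "\<lambda>k. (real k + radau_theta k) / real n"
  let ?a = "\<lambda>k. if k < n then node_wt (radau_theta k) / real n else - left_wt (radau_theta n) / real n"
  show "strict_mono_on {..<n} ?\<tau>"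
  proof (rule strict_mono_onI)
    fix i j :: nat assume "i < j"
    then have "real i + 1 \<le> real j"
      by simp
    then have "real i + radau_theta i < real j + radau_theta j"
      using radau_theta_in_unit[of i] radau_theta_in_unit[of j] by linarith
    then show "?\<tau> i < ?\<tau> j"
      using \<open>0 < n\<close> by (simp add: divide_strict_right_mono)
  qed
  show "\<forall>k<n. 0 < ?\<tau> k \<and> ?\<tau> k < 1"
  proof (intro allI impI)
    fix k assume "k < n"
    then have "real k + 1 \<le> real n"
      by simp
    then show "0 < ?\<tau> k \<and> ?\<tau> k < 1"
      using radau_theta_in_unit[of k] \<open>0 < n\<close> by (simp add: add_nonneg_pos)
  qed
  show "radau_sum n = (\<lambda>f. (\<Sum>k<n. ?a k * f (?\<tau> k)) + ?a n * f 1)"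
    by (simp add: radau_sum_def fun_eq_iff)
  show "\<forall>f\<in>quadratic_splines n. remainder (radau_sum n) f = 0"
    using remainder_radau_sum_spline[OF assms] by blast
qed

section \<open>Test splines and uniqueness of the right Radau formula\<close>

definition bubble :: "nat \<Rightarrow> nat \<Rightarrow> real \<Rightarrow> real" where
  "bubble n k x = max 0 ((real n * x - real k) * (real k + 1 - real n * x))"

text \<open>The hat function of the knot k/n, coupling the adjacent cells, whereas
  \<open>bubble\<close> lives in one cell and vanishes at all knots. The n bubbles and n + 1 tents
  match the dimension 2n + 1 of the spline space, so testing on them loses nothing.\<close>

definition tent :: "nat \<Rightarrow> nat \<Rightarrow> real \<Rightarrow> real" where
  "tent n k x = max 0 (1 - \<bar>real n * x - real k\<bar>)"

lemma quadratic_splinesI: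
  assumes cont: "continuous_on {0..1} f"
    and f: "\<And>k. k < n \<Longrightarrow> \<exists>a b c. \<forall>x. real k < real n * x \<and> real n * x < real k + 1 \<longrightarrow> f x = a + b * x + c * x\<^sup>2"
  shows "f \<in> quadratic_splines n"
  unfolding quadratic_splines_def
proof (intro CollectI conjI cont allI impI)
  fix k assume "k < n"
  then obtain a b c where abc: "\<And>x. \<lbrakk>real k < real n * x; real n * x < real k + 1\<rbrakk> \<Longrightarrow> f x = a + b * x + c * x\<^sup>2"
    using f by meson
  have "f x = poly [:a, b, c:] x" if "x \<in> {real k / real n<..<real (Suc k) / real n}" for x
    using abc[of x] that \<open>k < n\<close> by (auto simp: field_simps power2_eq_square)
  then show "\<exists>p. degree p \<le> 2 \<and> (\<forall>x\<in>{real k / real n<..<real (Suc k) / real n}. f x = poly p x)"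
    by (intro exI[of _ "[:a, b, c:]"]) auto
qed

lemma bubble_eq_0:
  assumes "j \<noteq> k" "real j < real n * x" "real n * x < real j + 1"
  shows "bubble n k x = 0"
proof (cases "j < k")
  case True
  then have "real j + 1 \<le> real k"
    by simp
  then show ?thesis
    using assms by (simp add: bubble_def mult_nonpos_nonneg)
next
  case False
  then have "real k + 1 \<le> real j"
    using assms(1) by simp
  then show ?thesis
    using assms by (simp add: bubble_def mult_nonneg_nonpos)
qed

lemma bubble_spline: "bubble n k \<in> quadratic_splines n"
proof (rule quadratic_splinesI)
  show "continuous_on {0..1} (bubble n k)"
    unfolding bubble_def by (intro continuous_intros)
  fix j :: nat
  show "\<exists>a b c. \<forall>x. real j < real n * x \<and> real n * x < real j + 1 \<longrightarrow> bubble n k x = a + b * x + c * x\<^sup>2"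
  proof (cases "j = k")
    case True
    have "bubble n k x = - real k * (real k + 1) + (2 * real k + 1) * real n * x + (- (real n)\<^sup>2) * x\<^sup>2"
      if "real j < real n * x" "real n * x < real j + 1" for x
    proof -
      have "bubble n k x = (real n * x - real k) * (real k + 1 - real n * x)"
        using that True by (simp add: bubble_def)
      then show ?thesis
        by (simp add: power2_eq_square algebra_simps)
    qed
    then show ?thesis
      by blast
  next
    case False
    then have "\<forall>x. real j < real n * x \<and> real n * x < real j + 1 \<longrightarrow> bubble n k x = 0 + 0 * x + 0 * x\<^sup>2"
      using bubble_eq_0 by simp
    then show ?thesis
      by blast
  qed
qed

lemma tent_in_cell:
  assumes "real j < real n * x" "real n * x < real j + 1"
  shows "tent n k x = (if j = k then real k + 1 - real n * x else if Suc j = k then real n * x - real j else 0)"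
proof -
  consider "j = k" | "Suc j = k" | "real j + 2 \<le> real k" | "real k + 1 \<le> real j"
    by linarith
  then show ?thesis
    using assms by cases (auto simp: tent_def)
qed

lemma tent_spline: "tent n k \<in> quadratic_splines n"
proof (rule quadratic_splinesI)
  show "continuous_on {0..1} (tent n k)"
    unfolding tent_def by (intro continuous_intros)
  fix j :: nat
  let ?P = "\<lambda>a b c. \<forall>x. real j < real n * x \<and> real n * x < real j + 1 \<longrightarrow> tent n k x = a + b * x + c * x\<^sup>2"
  consider "j = k" | "Suc j = k" | "j \<noteq> k" "Suc j \<noteq> k"
    by blast
  then show "\<exists>a b c. ?P a b c"
  proof cases
    case 1
    then have "?P (real k + 1) (- real n) 0"
      by (auto simp: tent_in_cell)
    then show ?thesis by blast
  next
    case 2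
    then have "?P (- real j) (real n) 0"
      by (auto simp: tent_in_cell)
    then show ?thesis by blast
  next
    case 3
    then have "?P 0 0 0"
      by (auto simp: tent_in_cell)
    then show ?thesis by blast
  qed
qed

text \<open>With one node per cell, only the nodes of cells j - 1 and j meet the tent at knot j; the
  conditionals drop the missing cell at j = 0 and j = n.\<close>

lemma sum_tent:
  assumes cell: "\<And>k. k < n \<Longrightarrow> real k < real n * t k \<and> real n * t k < real k + 1"
  shows "(\<Sum>k<n. a k * tent n j (t k))
    = (if j < n then a j * (real j + 1 - real n * t j) else 0)
      + (if 0 < j \<and> j \<le> n then a (j - 1) * (real n * t (j - 1) - real (j - 1)) else 0)"
proof -
  have "(\<Sum>k<n. a k * tent n j (t k))
      = (\<Sum>k<n. (if k = j then a j * (real j + 1 - real n * t j) else 0)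
          + (if Suc k = j then a (j - 1) * (real n * t (j - 1) - real (j - 1)) else 0))"
  proof (rule sum.cong[OF refl])
    fix k assume "k \<in> {..<n}"
    then have "tent n j (t k)
        = (if k = j then real j + 1 - real n * t k else if Suc k = j then real n * t k - real k else 0)"
      using cell[of k] by (intro tent_in_cell) auto
    then show "a k * tent n j (t k) = (if k = j then a j * (real j + 1 - real n * t j) else 0)
          + (if Suc k = j then a (j - 1) * (real n * t (j - 1) - real (j - 1)) else 0)"
      by auto
  qed
  also have "\<dots> = (if j < n then a j * (real j + 1 - real n * t j) else 0)
      + (\<Sum>k<n. if Suc k = j then a (j - 1) * (real n * t (j - 1) - real (j - 1)) else 0)"
    by (simp add: sum.distrib sum.delta')
  also have "(\<Sum>k<n. if Suc k = j then a (j - 1) * (real n * t (j - 1) - real (j - 1)) else 0)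
      = (if 0 < j \<and> j \<le> n then a (j - 1) * (real n * t (j - 1) - real (j - 1)) else 0)"
    by (cases j) (auto simp: sum.delta Suc_le_eq)
  finally show ?thesis .
qed

lemma sum_bubble:
  assumes cell: "\<And>k. k < n \<Longrightarrow> real k < real n * t k \<and> real n * t k < real k + 1" and "j < n"
  shows "(\<Sum>k<n. a k * bubble n j (t k)) = a j * ((real n * t j - real j) * (real j + 1 - real n * t j))"
proof -
  have "(\<Sum>k<n. a k * bubble n j (t k))
      = (\<Sum>k<n. if k = j then a j * ((real n * t j - real j) * (real j + 1 - real n * t j)) else 0)"
    using cell bubble_eq_0 by (intro sum.cong) (auto simp: bubble_def intro!: bubble_eq_0)
  then show ?thesis
    using \<open>j < n\<close> by simp
qed

text \<open>Identifies the node found in cell k as the k-th node: the sequence gains at least one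
  per step, and only n values are available.\<close>

lemma strictly_increasing_self_map_id:
  fixes s :: "nat \<Rightarrow> nat"
  assumes "\<And>k. k < n \<Longrightarrow> s k < n" and "\<And>k. Suc k < n \<Longrightarrow> s k < s (Suc k)" and "k < n"
  shows "s k = k"
proof -
  have step: "s i + j \<le> s (i + j)" if "i + j < n" for i j
    using that
  proof (induction j)
    case (Suc j)
    then show ?case
      using assms(2)[of "i + j"] by simp
  qed simp
  have "k \<le> s k"
    using step[of 0 k] \<open>k < n\<close> by simp
  moreover have "s k + (n - 1 - k) \<le> s (n - 1)"
    using step[of k "n - 1 - k"] \<open>k < n\<close> by simp
  moreover have "s (n - 1) < n"
    using assms(1) \<open>k < n\<close> by simp
  ultimately show ?thesis
    using \<open>k < n\<close> by simp
qed

text \<open>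
  The bubbles force exactly one node into each cell, and the bubble and the tent at the left end of
  a cell then determine its node and weight from those of the previous cell.
\<close>

lemma is_right_radau_unique:
  assumes "0 < n" and Q: "is_right_radau n Q"
  shows "Q = radau_sum n"
proof -
  obtain a \<tau> where mono: "strict_mono_on {..<n} \<tau>" and unit: "\<And>k. k < n \<Longrightarrow> 0 < \<tau> k \<and> \<tau> k < 1"
    and Q_eq: "Q = (\<lambda>f. (\<Sum>k<n. a k * f (\<tau> k)) + a n * f 1)"
    and exact: "\<And>f. f \<in> quadratic_splines n \<Longrightarrow> remainder Q f = 0"
    using Q unfolding is_right_radau_def by blast
  define \<sigma> where "\<sigma> k = (real k + radau_theta k) / real n" for k
  define b where "b k = (if k < n then node_wt (radau_theta k) / real n else - left_wt (radau_theta n) / real n)" for k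
  have sum_eq: "radau_sum n f = (\<Sum>k<n. b k * f (\<sigma> k)) + b n * f 1" for f
    by (simp add: radau_sum_def b_def \<sigma>_def)
  have agree: "(\<Sum>k<n. a k * f (\<tau> k)) + a n * f 1 = (\<Sum>k<n. b k * f (\<sigma> k)) + b n * f 1"
    if "f \<in> quadratic_splines n" for f
    using exact[OF that] remainder_radau_sum_spline[OF \<open>0 < n\<close> that]
    unfolding remainder_def sum_eq by (simp add: Q_eq)
  have n\<sigma>: "real n * \<sigma> k = real k + radau_theta k" for k
    using \<open>0 < n\<close> by (simp add: \<sigma>_def)
  have cell_\<sigma>: "real k < real n * \<sigma> k \<and> real n * \<sigma> k < real k + 1" for k
    using radau_theta_in_unit[of k] by (simp add: n\<sigma>)
  have bubble_1: "bubble n j 1 = 0" if "j < n" for j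
    using that by (auto simp: bubble_def mult_nonneg_nonpos)
  have bubble_\<sigma>: "(\<Sum>k<n. b k * bubble n j (\<sigma> k)) = b j * (radau_theta j * (1 - radau_theta j))" if "j < n" for j
    using sum_bubble[of n \<sigma> j b, OF cell_\<sigma> that] by (simp add: n\<sigma>)
  have b_pos: "0 < b j" if "j < n" for j
    using that \<open>0 < n\<close> cell_wt_bounds(1)[of "radau_theta j"] radau_theta_bounds[of j] by (simp add: b_def)
  \<comment> \<open>In a cell without a node the bubble would have the value 0 under
    \<open>Q\<close> but a positive value under \<open>radau_sum n\<close>.\<close>
  have "\<exists>i<n. real k < real n * \<tau> i \<and> real n * \<tau> i < real k + 1" if "k < n" for k
  proof (rule ccontr)
    assume no: "\<not> ?thesis"
    have "bubble n k (\<tau> i) = 0" if "i < n" for i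
    proof -
      have "real n * \<tau> i \<le> real k \<or> real k + 1 \<le> real n * \<tau> i"
        using no that by force
      then show ?thesis
        by (auto simp: bubble_def mult_nonpos_nonneg mult_nonneg_nonpos)
    qed
    then have "b k * (radau_theta k * (1 - radau_theta k)) = 0"
      using agree[OF bubble_spline, of k] bubble_1[OF that] bubble_\<sigma>[OF that] by simp
    then show False
      using b_pos[OF that] radau_theta_in_unit[of k] by simp
  qed
  then obtain s where s: "\<And>k. k < n \<Longrightarrow> s k < n \<and> real k < real n * \<tau> (s k) \<and> real n * \<tau> (s k) < real k + 1"
    by metis
  have "s k < s (Suc k)" if "Suc k < n" for k
  proof (rule ccontr)
    assume "\<not> ?thesis"
    then have "\<tau> (s (Suc k)) \<le> \<tau> (s k)"
      using mono s[of k] s[of "Suc k"] that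
      by (meson Suc_lessD lessThan_iff not_le strict_mono_on_leD)
    then have "real n * \<tau> (s (Suc k)) \<le> real n * \<tau> (s k)"
      by (simp add: mult_left_mono)
    moreover have "real n * \<tau> (s k) < real k + 1" "real (Suc k) < real n * \<tau> (s (Suc k))"
      using s[of k] s[of "Suc k"] that by auto
    ultimately show False
      using of_nat_Suc[of k, where 'a = real] by linarith
  qed
  then have s_id: "s k = k" if "k < n" for k
    using strictly_increasing_self_map_id[of n s k] s that by blast
  have cell_\<tau>: "real k < real n * \<tau> k \<and> real n * \<tau> k < real k + 1" if "k < n" for k
    using s[OF that] s_id[OF that] by simp
  \<comment> \<open>The relative position of the k-th node in its cell, to be identified with
    \<open>radau_theta k\<close>.\<close>
  define r where "r k = real n * \<tau> k - real k" for k
  have bub: "a j * (r j * (1 - r j)) = b j * (radau_theta j * (1 - radau_theta j))" if "j < n" for j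
    using agree[OF bubble_spline, of j] bubble_1[OF that] bubble_\<sigma>[OF that]
      sum_bubble[of n \<tau> j a, OF cell_\<tau> that] by (simp add: r_def algebra_simps)
  have tent_1: "tent n j 1 = (if j = n then 1 else 0)" if "j \<le> n" for j
    using that by (cases "j = n") (auto simp: tent_def not_le dest: less_imp_Suc_add)
  have ten: "(if j < n then a j * (1 - r j) else 0) + (if 0 < j then a (j - 1) * r (j - 1) else 0) + (if j = n then a n else 0)
      = (if j < n then b j * (1 - radau_theta j) else 0) + (if 0 < j then b (j - 1) * radau_theta (j - 1) else 0)
        + (if j = n then b n else 0)" if "j \<le> n" for j
  proof -
    have r: "real j + 1 - real n * \<tau> j = 1 - r j" for j
      by (simp add: r_def)
    have \<theta>: "real j + 1 - real n * \<sigma> j = 1 - radau_theta j" "real n * \<sigma> j - real j = radau_theta j" for j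
      by (simp_all add: n\<sigma>)
    have \<tau>_sum: "(\<Sum>k<n. a k * tent n j (\<tau> k))
      = (if j < n then a j * (real j + 1 - real n * \<tau> j) else 0)
        + (if 0 < j \<and> j \<le> n then a (j - 1) * (real n * \<tau> (j - 1) - real (j - 1)) else 0)"
      by (rule sum_tent) (rule cell_\<tau>)
    show ?thesis
      using agree[OF tent_spline, of j] that
      unfolding \<tau>_sum sum_tent[OF cell_\<sigma>] r \<theta> r_def[symmetric] tent_1[OF that]
      by (auto split: if_splits)
  qed
  \<comment> \<open>The bubble supplies a r (1 - r) and the tent a (1 - r): their ratio yields r,
    and then a follows.\<close>
  have determined: "a k = b k \<and> r k = radau_theta k"
    if "k < n" and eq: "a k * (1 - r k) = b k * (1 - radau_theta k)" for k
  proof -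
    have "b k * (1 - radau_theta k) * r k = a k * (r k * (1 - r k))"
      unfolding eq[symmetric] by simp
    also have "\<dots> = b k * (1 - radau_theta k) * radau_theta k"
      unfolding bub[OF \<open>k < n\<close>] by simp
    finally have "r k = radau_theta k"
      using b_pos[OF \<open>k < n\<close>] radau_theta_in_unit[of k] by simp
    then show ?thesis
      using eq radau_theta_in_unit[of k] by simp
  qed
  have "a k = b k \<and> r k = radau_theta k" if "k < n" for k
    using that
  proof (induction k)
    case 0
    then show ?case
      using ten[of 0] by (intro determined) auto
  next
    \<comment> \<open>In the tent at knot k + 1 the contribution of cell k already agrees and
      cancels.\<close>
    case (Suc k)
    then show ?case
      using ten[of "Suc k"] by (intro determined) (auto simp del: radau_theta.simps)
  qed
  then have ab: "a k = b k" "r k = radau_theta k" if "k < n" for k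
    using that by auto
  have "\<tau> k = \<sigma> k" if "k < n" for k
    using ab(2)[OF that] \<open>0 < n\<close> by (simp add: r_def \<sigma>_def field_simps)
  moreover have "a n = b n"
    using ten[of n] ab[of "n - 1"] \<open>0 < n\<close> by simp
  ultimately show ?thesis
    unfolding Q_eq using ab by (simp add: sum_eq fun_eq_iff)
qed

lemma radau_right_eq:
  assumes "0 < n"
  shows "radau_right n = radau_sum n" "\<exists>!Q. is_right_radau n Q"
proof -
  show ex1: "\<exists>!Q. is_right_radau n Q"
    using is_right_radau_radau_sum[OF assms] is_right_radau_unique[OF assms] by blast
  show "radau_right n = radau_sum n"
    unfolding radau_right_def
    using is_right_radau_radau_sum[OF assms] is_right_radau_unique[OF assms] by (intro the_equality)
qed

section \<open>Remainder and error constant\<close>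

lemma sum_even_odd_pairs:
  fixes f :: "nat \<Rightarrow> 'a::comm_monoid_add"
  shows "(\<Sum>k<2 * n. f k) = (\<Sum>k<n. f (2 * k) + f (2 * k + 1))"
  by (induction n) (auto simp: add_ac)

lemma C2_derivs_cell:
  assumes "C2_derivs f f1 f2" "k < n"
  shows "C2_derivs (\<lambda>s. f (real k / real n + 1 / real n * s))
      (\<lambda>s. 1 / real n * f1 (real k / real n + 1 / real n * s))
      (\<lambda>s. (1 / real n)\<^sup>2 * f2 (real k / real n + 1 / real n * s))"
  using C2_derivs_affine[OF assms(1) cell_subset_unit[OF assms(2)]] .

lemma cell_mono:
  assumes "k < n" and mono: "\<And>x y. \<lbrakk>0 \<le> x; x \<le> y; y \<le> 1\<rbrakk> \<Longrightarrow> f2 x \<le> f2 y"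
    and xy: "0 \<le> x" "x \<le> y" "y \<le> 1"
  shows "(1 / real n)\<^sup>2 * f2 (real k / real n + 1 / real n * x) \<le> (1 / real n)\<^sup>2 * f2 (real k / real n + 1 / real n * y)"
proof (rule mult_left_mono[OF mono])
  show "0 \<le> real k / real n + 1 / real n * x" "real k / real n + 1 / real n * y \<le> 1"
    using cell_subset_unit[OF \<open>k < n\<close>, of x] cell_subset_unit[OF \<open>k < n\<close>, of y] xy by auto
  show "real k / real n + 1 / real n * x \<le> real k / real n + 1 / real n * y"
    using xy by (simp add: divide_right_mono)
qed simp

lemma remainder_radau_sum_nonpos:
  assumes "0 < n" and f: "C2_derivs f f1 f2"
    and mono: "\<And>x y. \<lbrakk>0 \<le> x; x \<le> y; y \<le> 1\<rbrakk> \<Longrightarrow> f2 x \<le> f2 y"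
  shows "remainder (radau_sum n) f \<le> 0"
proof -
  have "cell_rem (radau_theta k) (\<lambda>s. f (real k / real n + 1 / real n * s)) \<le> 0" if "k < n" for k
    using radau_theta_bounds[of k]
    by (intro cell_rem_nonpos[OF _ _ C2_derivs_cell[OF f that]] cell_mono[OF that mono]) auto
  then show ?thesis
    unfolding remainder_radau_sum[OF assms(1) C2_derivs_continuous(1)[OF f]]
    by (intro divide_nonpos_nonneg sum_nonpos) auto
qed

lemma remainder_radau_sum_double:
  assumes "0 < n" and f: "C2_derivs f f1 f2"
    and mono: "\<And>x y. \<lbrakk>0 \<le> x; x \<le> y; y \<le> 1\<rbrakk> \<Longrightarrow> f2 x \<le> f2 y"
  shows "remainder (radau_sum n) f \<le> remainder (radau_sum (2 * n)) f"
proof -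
  define t where "t k = cell_rem (radau_theta k) (\<lambda>s. f (real k / real (2 * n) + 1 / real (2 * n) * s))" for k
  have refine: "2 * cell_rem (radau_theta k) (\<lambda>s. f (real k / real n + 1 / real n * s)) \<le> t (2 * k) + t (2 * k + 1)"
    if "k < n" for k
  proof -
    let ?g = "\<lambda>s. f (real k / real n + 1 / real n * s)"
    have "2 * cell_rem (radau_theta k) ?g
        \<le> cell_rem (radau_theta (2 * k)) (\<lambda>s. ?g (s / 2)) + cell_rem (radau_theta (2 * k + 1)) (\<lambda>s. ?g (1 / 2 + s / 2))"
      using radau_theta_bounds left_wt_theta_Suc[of "2 * k"]
      by (intro cell_rem_refine[OF _ _ _ _ _ _ left_wt_theta_double _ C2_derivs_cell[OF f that] cell_mono[OF that mono]])
        (auto simp del: radau_theta.simps)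
    moreover have "real k / real n + 1 / real n * (s / 2) = real (2 * k) / real (2 * n) + 1 / real (2 * n) * s"
      "real k / real n + 1 / real n * (1 / 2 + s / 2) = real (2 * k + 1) / real (2 * n) + 1 / real (2 * n) * s" for s
      using \<open>0 < n\<close> by (simp_all add: field_simps)
    ultimately show ?thesis
      unfolding t_def by (simp only:)
  qed
  have "2 * (\<Sum>k<n. cell_rem (radau_theta k) (\<lambda>s. f (real k / real n + 1 / real n * s))) \<le> (\<Sum>k<2 * n. t k)"
    unfolding sum_even_odd_pairs sum_distrib_left by (intro sum_mono refine) simp
  moreover have "remainder (radau_sum (2 * n)) f = (\<Sum>k<2 * n. t k) / real (2 * n)"
    unfolding t_def using \<open>0 < n\<close> by (intro remainder_radau_sum C2_derivs_continuous(1)[OF f]) simp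
  ultimately show ?thesis
    unfolding remainder_radau_sum[OF \<open>0 < n\<close> C2_derivs_continuous(1)[OF f]]
    using \<open>0 < n\<close> by (simp add: divide_simps)
qed

text \<open>One point per cell is kept, as the limit for (b) needs. Of the power n^4, three factors
  come from rescaling the third derivative and one from the cell length.\<close>

lemma remainder_radau_sum_mean_values:
  assumes "0 < n" and f: "C2_derivs f f1 f2"
    and f3: "\<And>x. x \<in> {0..1} \<Longrightarrow> (f2 has_real_derivative f3 x) (at x within {0..1})"
    and cont: "continuous_on {0..1} f3"
  shows "\<exists>\<xi>. (\<forall>k<n. \<exists>s\<in>{0..1}. \<xi> k = real k / real n + 1 / real n * s) \<and>
      remainder (radau_sum n) f = - (\<Sum>k<n. (1 - 2 * radau_theta k) / 72 * f3 (\<xi> k)) / real n ^ 4"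
proof -
  have "\<exists>s\<in>{0..1}. cell_rem (radau_theta k) (\<lambda>s. f (real k / real n + 1 / real n * s))
      = - ((1 - 2 * radau_theta k) / 72) * ((1 / real n) ^ 3 * f3 (real k / real n + 1 / real n * s))" if "k < n" for k
  proof (rule cell_rem_mean_value[OF _ _ C2_derivs_cell[OF f that]])
    have maps: "(\<lambda>s. real k / real n + 1 / real n * s) ` {0..1} \<subseteq> {0..1}"
      using cell_subset_unit[OF that] by blast
    show "continuous_on {0..1} (\<lambda>s. (1 / real n) ^ 3 * f3 (real k / real n + 1 / real n * s))"
      by (intro continuous_intros continuous_on_compose2[OF cont]) (use maps in auto)
    fix x :: real assume x: "x \<in> {0..1}"
    have "(f2 has_real_derivative f3 (real k / real n + 1 / real n * x))
        (at (real k / real n + 1 / real n * x) within (\<lambda>s. real k / real n + 1 / real n * s) ` {0..1})"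
      using f3[OF cell_subset_unit[OF that x]] maps by (rule DERIV_subset)
    moreover have "((\<lambda>s. real k / real n + 1 / real n * s) has_real_derivative 1 / real n) (at x within {0..1})"
      using \<open>0 < n\<close> by (auto intro!: derivative_eq_intros)
    ultimately have "((\<lambda>s. f2 (real k / real n + 1 / real n * s)) has_real_derivative
        f3 (real k / real n + 1 / real n * x) * (1 / real n)) (at x within {0..1})"
      using DERIV_image_chain[of f2 _ "\<lambda>s. real k / real n + 1 / real n * s" x "{0..1}"]
      by (simp only: o_def)
    then have "((\<lambda>s. (1 / real n)\<^sup>2 * f2 (real k / real n + 1 / real n * s)) has_real_derivative
        (1 / real n)\<^sup>2 * (f3 (real k / real n + 1 / real n * x) * (1 / real n))) (at x within {0..1})"
      by (rule DERIV_cmult)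
    then show "((\<lambda>s. (1 / real n)\<^sup>2 * f2 (real k / real n + 1 / real n * s)) has_real_derivative
        (1 / real n) ^ 3 * f3 (real k / real n + 1 / real n * x)) (at x within {0..1})"
      by (simp add: power2_eq_square power3_eq_cube)
  qed (use radau_theta_bounds[of k] in auto)
  then obtain s where s: "\<And>k. k < n \<Longrightarrow> s k \<in> {0..1}"
    "\<And>k. k < n \<Longrightarrow> cell_rem (radau_theta k) (\<lambda>s. f (real k / real n + 1 / real n * s))
      = - ((1 - 2 * radau_theta k) / 72) * ((1 / real n) ^ 3 * f3 (real k / real n + 1 / real n * s k))"
    by metis
  have "remainder (radau_sum n) f
      = (\<Sum>k<n. - ((1 - 2 * radau_theta k) / 72) * ((1 / real n) ^ 3 * f3 (real k / real n + 1 / real n * s k))) / real n"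
    unfolding remainder_radau_sum[OF assms(1) C2_derivs_continuous(1)[OF f]] using s(2) by simp
  also have "\<dots> = - (\<Sum>k<n. (1 - 2 * radau_theta k) / 72 * f3 (real k / real n + 1 / real n * s k)) / real n ^ 4"
    by (simp add: sum_divide_distrib sum_negf power_divide power3_eq_cube power4_eq_xxxx mult_ac)
  finally show ?thesis
    using s(1) by (intro exI[of _ "\<lambda>k. real k / real n + 1 / real n * s k"]) auto
qed

text \<open>The modulus of the error constant, shared by the right and the left formula.\<close>

definition radau_const :: "nat \<Rightarrow> real" where
  "radau_const n = (\<Sum>k<n. (1 - 2 * radau_theta k) / 72) / real n ^ 4"

lemma radau_theta_weight_pos: "0 < (1 - 2 * radau_theta k) / 72"
  using radau_theta_bounds[of k] by simp

lemma radau_const_pos: "0 < n \<Longrightarrow> 0 < radau_const n"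
  unfolding radau_const_def by (intro divide_pos_pos sum_pos radau_theta_weight_pos) auto

text \<open>A mean of values of \<open>f3\<close> with positive weights lies between its extreme
  values and is therefore itself a value.\<close>

lemma remainder_radau_sum_mean_value:
  assumes "0 < n" and f: "C2_derivs f f1 f2"
    and f3: "\<And>x. x \<in> {0..1} \<Longrightarrow> (f2 has_real_derivative f3 x) (at x within {0..1})"
    and cont: "continuous_on {0..1} f3"
  shows "\<exists>\<xi>\<in>{0..1}. remainder (radau_sum n) f = - radau_const n * f3 \<xi>"
proof -
  obtain \<xi> where \<xi>: "\<And>k. k < n \<Longrightarrow> \<exists>s\<in>{0..1}. \<xi> k = real k / real n + 1 / real n * s"
    and rem: "remainder (radau_sum n) f = - (\<Sum>k<n. (1 - 2 * radau_theta k) / 72 * f3 (\<xi> k)) / real n ^ 4"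
    using remainder_radau_sum_mean_values[OF assms] by blast
  obtain l u where img: "f3 ` {0..1} = {l..u}"
    using continuous_image_closed_interval[OF _ cont] by auto
  define W where "W = (\<Sum>k<n. (1 - 2 * radau_theta k) / 72)"
  have "0 < W"
    unfolding W_def using \<open>0 < n\<close> by (intro sum_pos radau_theta_weight_pos) auto
  have lu: "l \<le> f3 (\<xi> k) \<and> f3 (\<xi> k) \<le> u" if "k < n" for k
  proof -
    have "\<xi> k \<in> {0..1}"
      using \<xi>[OF that] cell_subset_unit[OF that] by auto
    then show ?thesis
      using img by (metis atLeastAtMost_iff image_eqI)
  qed
  have "W * l \<le> (\<Sum>k<n. (1 - 2 * radau_theta k) / 72 * f3 (\<xi> k))"
    unfolding W_def sum_distrib_right using lu radau_theta_weight_pos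
    by (intro sum_mono mult_left_mono) (auto intro: less_imp_le)
  moreover have "(\<Sum>k<n. (1 - 2 * radau_theta k) / 72 * f3 (\<xi> k)) \<le> W * u"
    unfolding W_def sum_distrib_right using lu radau_theta_weight_pos
    by (intro sum_mono mult_left_mono) (auto intro: less_imp_le)
  ultimately have "(\<Sum>k<n. (1 - 2 * radau_theta k) / 72 * f3 (\<xi> k)) / W \<in> f3 ` {0..1}"
    unfolding img using \<open>0 < W\<close> by (simp add: pos_le_divide_eq pos_divide_le_eq mult.commute)
  then obtain x where "x \<in> {0..1}" "f3 x = (\<Sum>k<n. (1 - 2 * radau_theta k) / 72 * f3 (\<xi> k)) / W"
    by auto
  then show ?thesis
    using \<open>0 < W\<close> by (intro bexI[of _ x]) (simp_all add: rem radau_const_def flip: W_def)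
qed

text \<open>In y = 1 - 2 \<theta> the recursion is the Moebius map y -> (1 + 2 y)/(2 + 3 y) with
  fixed points 1/sqrt 3 and -1/sqrt 3. The coordinate (1 + sqrt 3 y)/(1 - sqrt 3 y) is multiplied by
  (2 + sqrt 3)^2 = 7 + 4 sqrt 3 in each step and equals 2 + sqrt 3 at the start y = 1/3; this
  coordinate is \<open>p\<close>.\<close>

lemma radau_theta_closed_form:
  "1 - 2 * radau_theta k = sqrt 3 / 3 - 2 * sqrt 3 / 3 * (1 / ((2 + sqrt 3) ^ (2 * k + 1) + 1))"
proof -
  have s: "sqrt 3 * sqrt 3 = 3" "0 < sqrt (3::real)"
    by simp_all
  have ss: "sqrt 3 * (sqrt 3 * x) = 3 * x" for x :: real
    by (simp flip: mult.assoc)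
  define p where "p k = (2 + sqrt 3) ^ (2 * k + 1)" for k :: nat
  have p_pos: "0 < p k" for k
    unfolding p_def by (intro zero_less_power) (simp add: add_pos_pos)
  have p_Suc: "p (Suc k) = (7 + 4 * sqrt 3) * p k" for k
    by (simp add: p_def algebra_simps ss)
  have "(1 - 2 * radau_theta k) * (sqrt 3 * (p k + 1)) = p k - 1"
  proof (induction k)
    case 0
    then show ?case
      by (simp add: p_def algebra_simps)
  next
    case (Suc k)
    define y where "y = 1 - 2 * radau_theta k"
    define P where "P = p k"
    have IH: "y * (sqrt 3 * (P + 1)) = P - 1"
      using Suc by (simp add: y_def P_def)
    have den: "0 < 2 + 3 * y"
      using radau_theta_bounds[of k] by (simp add: y_def)
    have "5 - 6 * radau_theta k = 2 + 3 * y" "1 - radau_theta k = (1 + y) / 2"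
      by (simp_all add: y_def)
    then have "1 - 2 * radau_theta (Suc k) = (1 + 2 * y) / (2 + 3 * y)"
      using den by (simp add: field_simps)
    then have step: "(1 - 2 * radau_theta (Suc k)) * (2 + 3 * y) = 1 + 2 * y"
      using den by simp
    \<comment> \<open>After multiplication by this nonzero factor, the claim is a polynomial
      identity modulo the induction hypothesis and sqrt 3 * sqrt 3 = 3.\<close>
    have "(sqrt 3 * (P + 1)) * ((1 + 2 * y) * (sqrt 3 * ((7 + 4 * sqrt 3) * P + 1)))
        = (sqrt 3 * (P + 1)) * ((2 + 3 * y) * ((7 + 4 * sqrt 3) * P - 1))"
      using IH s(1) by algebra
    moreover have nz: "sqrt 3 * (P + 1) \<noteq> 0"
      using p_pos[of k] by (simp add: P_def)
    ultimately have eq: "(1 + 2 * y) * (sqrt 3 * ((7 + 4 * sqrt 3) * P + 1)) = (2 + 3 * y) * ((7 + 4 * sqrt 3) * P - 1)"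
      by (simp only: mult_left_cancel[OF nz])
    have "(2 + 3 * y) * ((1 - 2 * radau_theta (Suc k)) * (sqrt 3 * (p (Suc k) + 1)))
        = ((1 - 2 * radau_theta (Suc k)) * (2 + 3 * y)) * (sqrt 3 * (p (Suc k) + 1))"
      by (simp only: mult_ac)
    also have "\<dots> = (2 + 3 * y) * (p (Suc k) - 1)"
      unfolding step p_Suc using eq by (simp only: P_def)
    finally have "(2 + 3 * y) * ((1 - 2 * radau_theta (Suc k)) * (sqrt 3 * (p (Suc k) + 1)))
        = (2 + 3 * y) * (p (Suc k) - 1)" .
    moreover have nz: "2 + 3 * y \<noteq> 0"
      using den by simp
    ultimately show ?case
      unfolding mult_left_cancel[OF nz] by (simp only:)
  qed
  then have "1 - 2 * radau_theta k = (p k - 1) / (sqrt 3 * (p k + 1))"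
    using p_pos[of k] by (simp add: eq_divide_eq)
  also have "\<dots> = sqrt 3 / 3 * ((p k - 1) / (p k + 1))"
  proof -
    have "1 / sqrt 3 = sqrt 3 / (3 :: real)"
      by (simp add: field_simps)
    moreover have "(p k - 1) / (sqrt 3 * (p k + 1)) = 1 / sqrt 3 * ((p k - 1) / (p k + 1))"
      by simp
    ultimately show ?thesis
      by (simp only:)
  qed
  also have "(p k - 1) / (p k + 1) = 1 - 2 * (1 / (p k + 1))"
    using p_pos[of k] by (simp add: field_simps)
  finally show ?thesis
    by (simp add: p_def algebra_simps)
qed

lemma radau_const_closed_form:
  "radau_const n = sqrt 3 / (216 * real n ^ 3)
     - sqrt 3 / (108 * real n ^ 4) * (\<Sum>k<n. 1 / ((2 + sqrt 3) ^ (2 * k + 1) + 1))"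
proof -
  have "radau_const n = (\<Sum>k<n. sqrt 3 / 216 - sqrt 3 / 108 * (1 / ((2 + sqrt 3) ^ (2 * k + 1) + 1))) / real n ^ 4"
  proof -
    have "(sqrt 3 / 3 - 2 * sqrt 3 / 3 * x) / 72 = sqrt 3 / 216 - sqrt 3 / 108 * x" for x
      by (simp add: field_simps)
    then show ?thesis
      unfolding radau_const_def radau_theta_closed_form by (simp only:)
  qed
  also have "\<dots> = (real n * (sqrt 3 / 216) - sqrt 3 / 108 * (\<Sum>k<n. 1 / ((2 + sqrt 3) ^ (2 * k + 1) + 1))) / real n ^ 4"
    by (simp add: sum_subtractf sum_distrib_left)
  also have "\<dots> = sqrt 3 / (216 * real n ^ 3)
     - sqrt 3 / (108 * real n ^ 4) * (\<Sum>k<n. 1 / ((2 + sqrt 3) ^ (2 * k + 1) + 1))"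
    by (cases "n = 0") (simp_all add: diff_divide_distrib power4_eq_xxxx power3_eq_cube)
  finally show ?thesis .
qed

section \<open>Numerical bounds\<close>

lemma sqrt_3_bounds: "1.7320508075 < sqrt 3" "sqrt 3 < (1.7320508076 :: real)"
proof -
  show "1.7320508075 < sqrt 3"
    by (rule real_less_rsqrt) (simp add: power2_eq_square)
  show "sqrt 3 < (1.7320508076 :: real)"
    by (rule real_less_lsqrt) (simp_all add: power2_eq_square)
qed

text \<open>At n = 4 the expression clears 1/269.14 by only about 1e-9, and at n = 3 it falls short;
  this explains the hypothesis and the tight enclosure of sqrt 3.\<close>

lemma radau_series_bounds:
  assumes "4 \<le> n"
  shows "1 / 269.14 < sqrt 3 / 108 * (\<Sum>k<n. 1 / ((2 + sqrt 3) ^ (2 * k + 1) + 1))"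
    and "sqrt 3 / 108 * (\<Sum>k<n. 1 / ((2 + sqrt 3) ^ (2 * k + 1) + 1)) < 1 / 269.13"
proof -
  define q where "q = 2 + sqrt (3::real)"
  define S where "S n = (\<Sum>k<n. 1 / (q ^ (2 * k + 1) + 1))" for n
  have q: "3.7 < q" "q < 3.8"
    using sqrt_3_bounds by (auto simp: q_def)
  have q2: "13 \<le> q\<^sup>2"
    using mult_strict_mono[of "3.7" q "3.7" q] q by (simp add: power2_eq_square)
  have [simp]: "sqrt 3 * (sqrt 3 * x) = 3 * x" for x :: real
    by (simp flip: mult.assoc)
  have pows: "q ^ 1 = 2 + sqrt 3" "q ^ 3 = 26 + 15 * sqrt 3" "q ^ 5 = 362 + 209 * sqrt 3"
    "q ^ 7 = 5042 + 2911 * sqrt 3" "q ^ 9 = 70226 + 40545 * sqrt 3"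
    by (simp_all add: q_def eval_nat_numeral algebra_simps)
  have "S 4 = 1 / (q ^ 1 + 1) + 1 / (q ^ 3 + 1) + 1 / (q ^ 5 + 1) + 1 / (q ^ 7 + 1)"
    by (simp add: S_def numeral_eq_Suc)
  then have S4: "S 4 = 1 / (3 + sqrt 3) + 1 / (27 + 15 * sqrt 3) + 1 / (363 + 209 * sqrt 3) + 1 / (5043 + 2911 * sqrt 3)"
    unfolding pows by simp
  have mono: "S 4 \<le> S n"
    unfolding S_def using assms q by (intro sum_mono2) auto
  \<comment> \<open>By q^2 >= 13 the remaining terms are dominated by a geometric series, and 13/12
    = 1/(1 - 1/13).\<close>
  have tail: "S n + 13 / 12 / q ^ (2 * n + 1) \<le> S 4 + 13 / 12 / q ^ 9"
    using assms
  proof (induction n rule: dec_induct)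
    case (step n)
    have pos: "0 < q ^ (2 * n + 1)"
      using q by simp
    have "1 / (q ^ (2 * n + 1) + 1) \<le> 1 / q ^ (2 * n + 1)"
      using pos by (intro divide_left_mono) auto
    moreover have "13 / 12 / q ^ (2 * Suc n + 1) \<le> 1 / 12 / q ^ (2 * n + 1)"
    proof -
      have "13 / 12 / q ^ (2 * Suc n + 1) = 13 / 12 / (q\<^sup>2 * q ^ (2 * n + 1))"
        by (simp add: power_add power2_eq_square)
      also have "\<dots> \<le> 13 / 12 / (13 * q ^ (2 * n + 1))"
        using pos q2 q by (intro divide_left_mono mult_right_mono) auto
      finally show ?thesis
        by simp
    qed
    ultimately show ?case
      using step.IH by (simp add: S_def)
  qed simp
  have "1 / 269.14 < sqrt 3 / 108 * S 4"
  proof -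
    let ?l = "1 / (3 + 1.7320508076) + 1 / (27 + 15 * 1.7320508076) + 1 / (363 + 209 * 1.7320508076)
      + 1 / (5043 + 2911 * 1.7320508076) :: real"
    have "?l \<le> S 4"
      unfolding S4 using sqrt_3_bounds by (intro add_mono divide_left_mono) auto
    then have "1.7320508075 / 108 * ?l \<le> sqrt 3 / 108 * S 4"
      using sqrt_3_bounds by (intro mult_mono) auto
    then show ?thesis
      by simp
  qed
  moreover have "sqrt 3 / 108 * S 4 \<le> sqrt 3 / 108 * S n"
    using mono by (intro mult_left_mono) auto
  ultimately show "1 / 269.14 < sqrt 3 / 108 * (\<Sum>k<n. 1 / ((2 + sqrt 3) ^ (2 * k + 1) + 1))"
    unfolding S_def q_def by linarith
  have "sqrt 3 / 108 * (S 4 + 13 / 12 / q ^ 9) < 1 / 269.13"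
  proof -
    let ?u = "1 / (3 + 1.7320508075) + 1 / (27 + 15 * 1.7320508075) + 1 / (363 + 209 * 1.7320508075)
      + 1 / (5043 + 2911 * 1.7320508075) + 13 / 12 / (70226 + 40545 * 1.7320508075) :: real"
    have "S 4 + 13 / 12 / q ^ 9 \<le> ?u"
      unfolding S4 pows using sqrt_3_bounds by (intro add_mono divide_left_mono) auto
    then have "sqrt 3 / 108 * (S 4 + 13 / 12 / q ^ 9) \<le> 1.7320508076 / 108 * ?u"
      using sqrt_3_bounds q by (intro mult_mono) (auto simp: S_def intro!: add_nonneg_nonneg sum_nonneg)
    also have "\<dots> < 1 / 269.13"
      by simp
    finally show ?thesis .
  qed
  moreover have "sqrt 3 / 108 * S n \<le> sqrt 3 / 108 * (S 4 + 13 / 12 / q ^ 9)"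
  proof (intro mult_left_mono)
    have "0 \<le> 13 / 12 / q ^ (2 * n + 1)"
      using q by simp
    then show "S n \<le> S 4 + 13 / 12 / q ^ 9"
      using tail by linarith
  qed simp
  ultimately show "sqrt 3 / 108 * (\<Sum>k<n. 1 / ((2 + sqrt 3) ^ (2 * k + 1) + 1)) < 1 / 269.13"
    unfolding S_def q_def by linarith
qed

lemma radau_const_bounds:
  assumes "4 \<le> n"
  shows "sqrt 3 / (216 * real n ^ 3) - 1 / (269.13 * real n ^ 4) < radau_const n"
    and "radau_const n < sqrt 3 / (216 * real n ^ 3) - 1 / (269.14 * real n ^ 4)"
proof -
  have n4: "0 < real n ^ 4"
    using assms by simp
  define T where "T = sqrt 3 / 108 * (\<Sum>k<n. 1 / ((2 + sqrt 3) ^ (2 * k + 1) + 1))"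
  have c: "radau_const n = sqrt 3 / (216 * real n ^ 3) - T / real n ^ 4"
  proof -
    have "a / (108 * N) * S = a / 108 * S / N" for a N S :: real
      by simp
    then show ?thesis
      unfolding radau_const_closed_form T_def by (rule arg_cong)
  qed
  have T: "1 / 269.14 < T" "T < 1 / 269.13"
    unfolding T_def by (fact radau_series_bounds[OF assms])+
  have "T / real n ^ 4 < 1 / 269.13 / real n ^ 4" "1 / 269.14 / real n ^ 4 < T / real n ^ 4"
    by (fact divide_strict_right_mono[OF T(2) n4] divide_strict_right_mono[OF T(1) n4])+
  then show "sqrt 3 / (216 * real n ^ 3) - 1 / (269.13 * real n ^ 4) < radau_const n"
    "radau_const n < sqrt 3 / (216 * real n ^ 3) - 1 / (269.14 * real n ^ 4)"
    unfolding c divide_divide_eq_left by linarith+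
qed

section \<open>The classes of the statement\<close>

lemma deriv01_works:
  assumes "f differentiable (at x within {0..1})"
  shows "(f has_real_derivative deriv01 f x) (at x within {0..1})"
  using assms unfolding deriv01_def vector_derivative_works has_real_derivative_iff_has_vector_derivative .

text \<open>Iterates of \<open>deriv01\<close> are known only on [0, 1], so agreement on that set
  has to suffice.\<close>

lemma deriv01_eqI:
  assumes "\<And>x. x \<in> {0..1} \<Longrightarrow> f x = g x" "(g has_real_derivative d) (at x within {0..1})" "x \<in> {0..1}"
  shows "f differentiable (at x within {0..1})" "deriv01 f x = d"
proof -
  have "(g has_vector_derivative d) (at x within {0..1})"
    using assms(2) by (simp add: has_real_derivative_iff_has_vector_derivative)
  then have d: "(f has_vector_derivative d) (at x within {0..1})"
    using assms by (intro has_vector_derivative_transform[of x "{0..1}" f g]) auto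
  then show "f differentiable (at x within {0..1})"
    by (rule differentiableI_vector)
  show "deriv01 f x = d"
    unfolding deriv01_def using assms(3) d by (intro vector_derivative_within_closed_interval) auto
qed

lemma C_class_2_derivs:
  assumes "f \<in> C_class 2"
  shows "C2_derivs f (deriv01 f) ((deriv01 ^^ 2) f)"
proof -
  have "(deriv01 ^^ i) f differentiable (at x within {0..1})" if "i < 2" "x \<in> {0..1}" for i x
    using assms that unfolding C_class_def by blast
  from this[of 0] this[of 1] have "\<forall>x\<in>{0..1}. f differentiable (at x within {0..1})"
    "\<forall>x\<in>{0..1}. deriv01 f differentiable (at x within {0..1})"
    by auto
  moreover have "continuous_on {0..1} ((deriv01 ^^ 2) f)"
    using assms unfolding C_class_def by blast
  ultimately show ?thesis
    unfolding C2_derivs_def by (auto simp: numeral_2_eq_2 intro: deriv01_works)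
qed

lemma C_class_3_derivs:
  assumes "f \<in> C_class 3"
  shows "C2_derivs f (deriv01 f) ((deriv01 ^^ 2) f)"
    and "x \<in> {0..1} \<Longrightarrow> ((deriv01 ^^ 2) f has_real_derivative (deriv01 ^^ 3) f x) (at x within {0..1})"
    and "continuous_on {0..1} ((deriv01 ^^ 3) f)"
proof -
  have diff: "(deriv01 ^^ i) f differentiable (at x within {0..1})" if "i < 3" "x \<in> {0..1}" for i x
    using assms that unfolding C_class_def by blast
  have d3: "((deriv01 ^^ 2) f has_real_derivative (deriv01 ^^ 3) f x) (at x within {0..1})" if "x \<in> {0..1}" for x
    using deriv01_works[OF diff[of 2 x]] that by (simp add: numeral_3_eq_3 numeral_2_eq_2)
  then show "x \<in> {0..1} \<Longrightarrow> ((deriv01 ^^ 2) f has_real_derivative (deriv01 ^^ 3) f x) (at x within {0..1})" .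
  show "continuous_on {0..1} ((deriv01 ^^ 3) f)"
    using assms unfolding C_class_def by blast
  have "continuous_on {0..1} ((deriv01 ^^ 2) f)"
    by (rule DERIV_continuous_on[OF d3])
  then have "f \<in> C_class 2"
    unfolding C_class_def using diff by auto
  then show "C2_derivs f (deriv01 f) ((deriv01 ^^ 2) f)"
    by (rule C_class_2_derivs)
qed

text \<open>The test function with third derivative 1: every error constant equals the remainder of
  this function, which makes the constant unique.\<close>

lemma cubic_C_class:
  shows "(\<lambda>x. x ^ 3 / 6) \<in> C_class 3" "x \<in> {0..1} \<Longrightarrow> (deriv01 ^^ 3) (\<lambda>x. x ^ 3 / 6) x = 1"
proof -
  let ?f = "\<lambda>x::real. x ^ 3 / 6"
  have d0: "((\<lambda>x. x ^ 3 / 6) has_real_derivative x\<^sup>2 / 2) (at x within {0..1})"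
    and d1: "((\<lambda>x. x\<^sup>2 / 2) has_real_derivative x) (at x within {0..1})"
    and d2: "((\<lambda>x. x) has_real_derivative 1) (at x within {0..1})" for x :: real
    by (auto intro!: derivative_eq_intros)
  have f1: "?f differentiable (at x within {0..1})" "deriv01 ?f x = x\<^sup>2 / 2" if "x \<in> {0..1}" for x
    using deriv01_eqI[OF refl d0 that] by auto
  have f2: "deriv01 ?f differentiable (at x within {0..1})" "deriv01 (deriv01 ?f) x = x" if "x \<in> {0..1}" for x
    using deriv01_eqI[OF f1(2) d1 that] by auto
  have f3: "deriv01 (deriv01 ?f) differentiable (at x within {0..1})" "deriv01 (deriv01 (deriv01 ?f)) x = 1"
    if "x \<in> {0..1}" for x
    using deriv01_eqI[OF f2(2) d2 that] by auto
  show "x \<in> {0..1} \<Longrightarrow> (deriv01 ^^ 3) ?f x = 1"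
    using f3 by (simp add: numeral_3_eq_3)
  have "continuous_on {0..1} (deriv01 (deriv01 (deriv01 ?f)))"
    by (rule continuous_on_eq[OF continuous_on_const[of _ 1]]) (simp add: f3(2))
  moreover have "(deriv01 ^^ i) ?f differentiable (at x within {0..1})" if "i < 3" "x \<in> {0..1}" for i x
  proof -
    have "i = 0 \<or> i = 1 \<or> i = 2"
      using that by auto
    then show ?thesis
      using f1(1)[OF that(2)] f2(1)[OF that(2)] f3(1)[OF that(2)] by (auto simp: numeral_2_eq_2)
  qed
  ultimately show "?f \<in> C_class 3"
    unfolding C_class_def by (simp add: numeral_3_eq_3)
qed

lemma error_constant_eqI:
  assumes "is_error_constant 3 Q c"
  shows "error_constant 3 Q = c"
  unfolding error_constant_def
proof (rule the_equality)
  show "is_error_constant 3 Q c"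
    by (rule assms)
  fix c' assume "is_error_constant 3 Q c'"
  with assms show "c' = c"
    unfolding is_error_constant_def using cubic_C_class by (metis mult.right_neutral)
qed

lemma remainder_radau_left:
  assumes "continuous_on {0..1} f"
  shows "remainder (radau_left n) f = remainder (radau_right n) (\<lambda>x. f (1 - x))"
proof -
  have "(f has_integral integral {0..1} f) {0..1}"
    using assms by (simp add: integrable_continuous_interval integrable_integral)
  then have "((\<lambda>x. f (- x)) has_integral integral {0..1} f) (cbox (- 1) 0)"
    using has_integral_reflect_lemma[of f "integral {0..1} f" 0 1] by simp
  from has_integral_affinity'[OF this zero_less_one, of "- 1"]
  have "((\<lambda>x. f (1 - x)) has_integral integral {0..1} f) {0..1}"
    by simp
  then show ?thesis
    by (simp add: remainder_def radau_left_def integral_unique)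
qed

lemma C2_derivs_reflect:
  assumes "C2_derivs f f1 f2"
  shows "C2_derivs (\<lambda>x. f (1 - x)) (\<lambda>x. - f1 (1 - x)) (\<lambda>x. f2 (1 - x))"
  using C2_derivs_affine[OF assms, of 1 "- 1"] by simp

lemma reflect_deriv:
  assumes "\<And>x. x \<in> {0..1} \<Longrightarrow> (f has_real_derivative f' x) (at x within {0..1})" "x \<in> {0..1}"
  shows "((\<lambda>x. f (1 - x)) has_real_derivative - f' (1 - x)) (at x within {0..1})"
proof -
  have "(\<lambda>x. 1 - x) ` {0..1} = {0..1::real}"
    by (auto simp: image_iff intro!: bexI[of _ "1 - _"])
  then have "(f has_real_derivative f' (1 - x)) (at (1 - x) within (\<lambda>x. 1 - x) ` {0..1})"
    using assms by simp
  moreover have "((\<lambda>x. 1 - x) has_real_derivative - 1) (at x within {0..1})"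
    by (auto intro!: derivative_eq_intros)
  ultimately show ?thesis
    using DERIV_image_chain[of f "f' (1 - x)" "\<lambda>x. 1 - x" x "{0..1}" "- 1"] by (simp add: o_def)
qed

text \<open>Reflection preserves the sign of the second derivative and flips that of the third;
  hence the opposite error constants.\<close>

lemma C_class_3_reflect:
  assumes "f \<in> C_class 3"
  shows "C2_derivs (\<lambda>x. f (1 - x)) (\<lambda>x. - deriv01 f (1 - x)) (\<lambda>x. (deriv01 ^^ 2) f (1 - x))"
    and "x \<in> {0..1} \<Longrightarrow> ((\<lambda>x. (deriv01 ^^ 2) f (1 - x)) has_real_derivative
           - (deriv01 ^^ 3) f (1 - x)) (at x within {0..1})"
    and "continuous_on {0..1} (\<lambda>x. - (deriv01 ^^ 3) f (1 - x))"
proof -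
  show "C2_derivs (\<lambda>x. f (1 - x)) (\<lambda>x. - deriv01 f (1 - x)) (\<lambda>x. (deriv01 ^^ 2) f (1 - x))"
    by (rule C2_derivs_reflect[OF C_class_3_derivs(1)[OF assms]])
  show "x \<in> {0..1} \<Longrightarrow> ((\<lambda>x. (deriv01 ^^ 2) f (1 - x)) has_real_derivative
           - (deriv01 ^^ 3) f (1 - x)) (at x within {0..1})"
    by (rule reflect_deriv[OF C_class_3_derivs(2)[OF assms]])
  show "continuous_on {0..1} (\<lambda>x. - (deriv01 ^^ 3) f (1 - x))"
    by (intro continuous_intros continuous_on_compose2[OF C_class_3_derivs(3)[OF assms]]) auto
qed

lemma error_constant_radau_right:
  assumes "0 < n"
  shows "is_error_constant 3 (radau_right n) (- radau_const n)"
  unfolding is_error_constant_def radau_right_eq(1)[OF assms]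
proof (intro conjI ballI)
  show "- radau_const n \<noteq> 0"
    using radau_const_pos[OF assms] by simp
  fix f assume "f \<in> C_class 3"
  note d = C_class_3_derivs[OF this]
  show "\<exists>\<xi>\<in>{0..1}. remainder (radau_sum n) f = - radau_const n * (deriv01 ^^ 3) f \<xi>"
    by (rule remainder_radau_sum_mean_value[OF assms d])
qed

lemma error_constant_radau_left:
  assumes "0 < n"
  shows "is_error_constant 3 (radau_left n) (radau_const n)"
  unfolding is_error_constant_def
proof (intro conjI ballI)
  show "radau_const n \<noteq> 0"
    using radau_const_pos[OF assms] by simp
  fix f assume f: "f \<in> C_class 3"
  have "\<exists>\<xi>\<in>{0..1}. remainder (radau_sum n) (\<lambda>x. f (1 - x)) = - radau_const n * - (deriv01 ^^ 3) f (1 - \<xi>)"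
    by (rule remainder_radau_sum_mean_value[OF assms C_class_3_reflect[OF f]])
  then obtain \<xi> where "\<xi> \<in> {0..1}" "remainder (radau_left n) f = radau_const n * (deriv01 ^^ 3) f (1 - \<xi>)"
    unfolding remainder_radau_left[OF C2_derivs_continuous(1)[OF C_class_3_derivs(1)[OF f]]] radau_right_eq(1)[OF assms]
    by auto
  then show "\<exists>\<xi>\<in>{0..1}. remainder (radau_left n) f = radau_const n * (deriv01 ^^ 3) f \<xi>"
    by (intro bexI[of _ "1 - \<xi>"]) auto
qed

text \<open>Writes the increment as a Riemann sum with points in the same cells that carry the mean
  values of the remainder, so that the two sums can be compared term by term.\<close>

lemma mean_values_on_grid:
  assumes "0 < n"
    and d: "\<And>x. x \<in> {0..1} \<Longrightarrow> (g has_real_derivative g' x) (at x within {0..1})"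
  shows "\<exists>\<eta>. (\<forall>k<n. \<exists>s\<in>{0..1}. \<eta> k = real k / real n + 1 / real n * s) \<and>
      g 1 - g 0 = (\<Sum>k<n. g' (\<eta> k)) / real n"
proof -
  have "\<exists>s\<in>{0..1}. g (real (Suc k) / real n) - g (real k / real n) = g' (real k / real n + 1 / real n * s) / real n"
    if "k < n" for k
  proof -
    have lt: "real k / real n < real (Suc k) / real n"
      using \<open>0 < n\<close> by (simp add: divide_strict_right_mono)
    have le: "real (Suc k) / real n \<le> 1" "0 \<le> real k / real n"
      using that by simp_all
    have sub: "{real k / real n..real (Suc k) / real n} \<subseteq> {0..1}"
      unfolding atLeastatMost_subset_iff using le by blast
    have "(g has_derivative (*) (g' x)) (at x within {real k / real n..real (Suc k) / real n})"
      if "real k / real n \<le> x" "x \<le> real (Suc k) / real n" for x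
    proof -
      have "x \<in> {0..1}"
        using that le unfolding atLeastAtMost_iff by linarith
      then have "(g has_real_derivative g' x) (at x within {real k / real n..real (Suc k) / real n})"
        using d DERIV_subset[OF _ sub] by blast
      then show ?thesis
        by (simp add: has_field_derivative_def)
    qed
    from mvt_simple[OF lt this] obtain z where z: "real k / real n < z" "z < real (Suc k) / real n"
      and eq: "g (real (Suc k) / real n) - g (real k / real n) = g' z * (real (Suc k) / real n - real k / real n)"
      by auto
    have "z = real k / real n + 1 / real n * (real n * z - real k)"
      using \<open>0 < n\<close> by (simp add: field_simps)
    moreover have "real n * z - real k \<in> {0..1}"
      using z \<open>0 < n\<close> by (auto simp: field_simps)
    moreover have "real (Suc k) / real n - real k / real n = 1 / real n"
      by (simp flip: diff_divide_distrib)
    ultimately show ?thesis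
      using eq by (intro bexI[of _ "real n * z - real k"]) (simp_all del: of_nat_Suc)
  qed
  then obtain s where s: "\<And>k. k < n \<Longrightarrow> s k \<in> {0..1}"
    "\<And>k. k < n \<Longrightarrow> g (real (Suc k) / real n) - g (real k / real n) = g' (real k / real n + 1 / real n * s k) / real n"
    by metis
  have "g 1 - g 0 = (\<Sum>k<n. g (real (Suc k) / real n) - g (real k / real n))"
    using \<open>0 < n\<close> by (subst sum_lessThan_telescope) simp
  also have "\<dots> = (\<Sum>k<n. g' (real k / real n + 1 / real n * s k)) / real n"
    using s(2) by (simp add: sum_divide_distrib del: of_nat_Suc)
  finally show ?thesis
    using s(1) by (intro exI[of _ "\<lambda>k. real k / real n + 1 / real n * s k"]) auto
qed

text \<open>A crude rate is enough: what matters is that the deviations from the limit weight have a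
  bounded sum.\<close>

lemma radau_theta_weight_limit:
  "\<bar>sqrt 3 / 216 - (1 - 2 * radau_theta k) / 72\<bar> \<le> (1 / 2) ^ k"
proof -
  have pow: "2 ^ k \<le> (2 + sqrt 3) ^ (2 * k + 1) + 1"
  proof -
    have "(2::real) ^ k \<le> (2 + sqrt 3) ^ k"
      by (intro power_mono) auto
    also have "\<dots> \<le> (2 + sqrt 3) ^ (2 * k + 1)"
      by (intro power_increasing) auto
    finally show ?thesis
      by simp
  qed
  define t where "t = 1 / ((2 + sqrt 3) ^ (2 * k + 1) + 1)"
  have t: "0 \<le> t" "t \<le> 1 / 2 ^ k"
    using pow unfolding t_def by (auto intro!: divide_left_mono simp: add_nonneg_pos)
  have "sqrt 3 / 216 - (1 - 2 * radau_theta k) / 72 = sqrt 3 / 108 * t"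
    unfolding radau_theta_closed_form t_def[symmetric] by (simp add: field_simps)
  moreover have "sqrt 3 / 108 * t \<le> 1 * t"
    using t sqrt_3_bounds by (intro mult_right_mono) auto
  moreover have "0 \<le> sqrt 3 / 108 * t"
    using t by simp
  ultimately have "\<bar>sqrt 3 / 216 - (1 - 2 * radau_theta k) / 72\<bar> \<le> t"
    by linarith
  then show ?thesis
    using t(2) unfolding power_one_over by linarith
qed

lemma remainder_radau_sum_limit:
  assumes f: "C2_derivs f f1 f2"
    and f3: "\<And>x. x \<in> {0..1} \<Longrightarrow> (f2 has_real_derivative f3 x) (at x within {0..1})"
    and cont: "continuous_on {0..1} f3"
  shows "(\<lambda>n. real n ^ 3 * remainder (radau_sum n) f) \<longlonglongrightarrow> - (sqrt 3 / 216) * (f2 1 - f2 0)"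
proof (rule LIMSEQ_I)
  fix e :: real assume "0 < e"
  let ?c = "sqrt 3 / 216 :: real"
  have "bounded (f3 ` {0..1})"
    using compact_continuous_image[OF cont] by (simp add: compact_imp_bounded)
  then obtain M where "0 < M" and M: "\<And>x. x \<in> {0..1} \<Longrightarrow> \<bar>f3 x\<bar> \<le> M"
    by (auto simp: bounded_pos)
  have "uniformly_continuous_on {0..1} f3"
    using cont by (intro compact_uniformly_continuous) auto
  then obtain d where "0 < d"
    and d: "\<And>x y. \<lbrakk>x \<in> {0..1}; y \<in> {0..1}; \<bar>y - x\<bar> < d\<rbrakk> \<Longrightarrow> \<bar>f3 y - f3 x\<bar> < e / 2"
    unfolding uniformly_continuous_on_def dist_real_def using \<open>0 < e\<close> by (metis half_gt_zero)
  \<comment> \<open>\<open>N1\<close> brings any two points of one cell closer than d;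
    \<open>N2\<close> makes the accumulated weight error 2 M / n smaller than e / 2.\<close>
  obtain N1 where N1: "1 / d < real N1"
    using reals_Archimedean2 by blast
  obtain N2 where N2: "4 * M / e < real N2"
    using reals_Archimedean2 by blast
  show "\<exists>n0. \<forall>n\<ge>n0. norm (real n ^ 3 * remainder (radau_sum n) f - - ?c * (f2 1 - f2 0)) < e"
  proof (intro exI allI impI)
    fix n assume n: "Suc (max N1 N2) \<le> n"
    then have "0 < n" "real N1 < real n" "real N2 < real n"
      by auto
    have "1 / real n < d"
    proof -
      have "1 / d < real n"
        using N1 \<open>real N1 < real n\<close> by linarith
      then have "1 < real n * d"
        using \<open>0 < d\<close> by (simp add: pos_divide_less_eq)
      then show ?thesis
        using \<open>0 < n\<close> by (simp add: pos_divide_less_eq mult.commute)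
    qed
    have "2 * M / real n < e / 2"
    proof -
      have "4 * M / e < real n"
        using N2 \<open>real N2 < real n\<close> by linarith
      then have "4 * M < real n * e"
        using \<open>0 < e\<close> by (simp add: pos_divide_less_eq)
      then show ?thesis
        using \<open>0 < n\<close> by (simp add: field_simps)
    qed
    obtain \<xi> where \<xi>: "\<And>k. k < n \<Longrightarrow> \<exists>s\<in>{0..1}. \<xi> k = real k / real n + 1 / real n * s"
      and rem: "remainder (radau_sum n) f = - (\<Sum>k<n. (1 - 2 * radau_theta k) / 72 * f3 (\<xi> k)) / real n ^ 4"
      using remainder_radau_sum_mean_values[OF \<open>0 < n\<close> assms] by blast
    obtain \<eta> where \<eta>: "\<And>k. k < n \<Longrightarrow> \<exists>s\<in>{0..1}. \<eta> k = real k / real n + 1 / real n * s"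
      and diff: "f2 1 - f2 0 = (\<Sum>k<n. f3 (\<eta> k)) / real n"
      using mean_values_on_grid[OF \<open>0 < n\<close> f3] by blast
    have "real n ^ 3 * remainder (radau_sum n) f - - ?c * (f2 1 - f2 0)
        = (\<Sum>k<n. ?c * f3 (\<eta> k) - (1 - 2 * radau_theta k) / 72 * f3 (\<xi> k)) / real n"
      unfolding rem diff sum_subtractf sum_distrib_left[symmetric] using \<open>0 < n\<close>
      by (simp add: diff_divide_distrib power3_eq_cube power4_eq_xxxx)
    also have "\<bar>\<dots>\<bar> \<le> (\<Sum>k<n. e / 2 + (1 / 2) ^ k * M) / real n"
    proof -
      have "\<bar>?c * f3 (\<eta> k) - (1 - 2 * radau_theta k) / 72 * f3 (\<xi> k)\<bar> \<le> e / 2 + (1 / 2) ^ k * M" if k: "k < n" for k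
      proof -
        obtain s t where st: "s \<in> {0..1}" "\<xi> k = real k / real n + 1 / real n * s"
          "t \<in> {0..1}" "\<eta> k = real k / real n + 1 / real n * t"
          using \<xi>[OF k] \<eta>[OF k] by blast
        have in01: "\<xi> k \<in> {0..1}" "\<eta> k \<in> {0..1}"
          using cell_subset_unit[OF k] st by auto
        have "\<bar>\<eta> k - \<xi> k\<bar> = 1 / real n * \<bar>t - s\<bar>"
          unfolding st(2,4) using \<open>0 < n\<close> by (simp add: abs_mult flip: diff_divide_distrib)
        also have "\<dots> \<le> 1 / real n * 1"
          using st by (intro mult_left_mono) auto
        finally have "\<bar>f3 (\<eta> k) - f3 (\<xi> k)\<bar> < e / 2"
          using \<open>1 / real n < d\<close> by (intro d in01) auto
        moreover have "\<bar>?c * (f3 (\<eta> k) - f3 (\<xi> k))\<bar> \<le> 1 * \<bar>f3 (\<eta> k) - f3 (\<xi> k)\<bar>"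
          unfolding abs_mult using sqrt_3_bounds by (intro mult_right_mono) auto
        ultimately have first: "\<bar>?c * (f3 (\<eta> k) - f3 (\<xi> k))\<bar> \<le> e / 2"
          by simp
        have second: "\<bar>(?c - (1 - 2 * radau_theta k) / 72) * f3 (\<xi> k)\<bar> \<le> (1 / 2) ^ k * M"
          unfolding abs_mult by (intro mult_mono radau_theta_weight_limit M in01) auto
        \<comment> \<open>The first part is small by uniform continuity, the second is summable over
          k.\<close>
        have split: "a * x - b * y = a * (x - y) + (a - b) * y" for a b x y :: real
          by (simp add: algebra_simps)
        show ?thesis
          unfolding split[of ?c] by (rule order_trans[OF abs_triangle_ineq add_mono[OF first second]])
      qed
      then show ?thesis
        unfolding abs_divide abs_of_nat by (intro divide_right_mono order_trans[OF sum_abs sum_mono]) auto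
    qed
    also have "\<dots> = e / 2 + (\<Sum>k<n. (1 / 2) ^ k) * M / real n"
      using \<open>0 < n\<close> by (simp add: sum.distrib sum_distrib_right add_divide_distrib)
    also have "\<dots> \<le> e / 2 + 2 * M / real n"
    proof -
      have "(\<Sum>k<n. (1 / 2 :: real) ^ k) \<le> 2"
        by (simp add: sum_gp_strict)
      then show ?thesis
        using \<open>0 < M\<close> by (intro add_left_mono divide_right_mono mult_right_mono) auto
    qed
    also have "\<dots> < e"
      using \<open>2 * M / real n < e / 2\<close> by simp
    finally show "norm (real n ^ 3 * remainder (radau_sum n) f - - ?c * (f2 1 - f2 0)) < e"
      by simp
  qed
qed

lemma remainder_radau_right_limit:
  assumes "f \<in> C_class 3"
  shows "(\<lambda>n. real n ^ 3 * remainder (radau_right n) f)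
    \<longlonglongrightarrow> - (sqrt 3 / 216) * ((deriv01 ^^ 2) f 1 - (deriv01 ^^ 2) f 0)"
  using remainder_radau_sum_limit[OF C_class_3_derivs[OF assms]]
  by (rule Lim_transform_eventually)
    (use radau_right_eq(1) in \<open>auto intro!: eventually_mono[OF eventually_gt_at_top[of 0]]\<close>)

lemma remainder_radau_left_limit:
  assumes "f \<in> C_class 3"
  shows "(\<lambda>n. real n ^ 3 * remainder (radau_left n) f)
    \<longlonglongrightarrow> sqrt 3 / 216 * ((deriv01 ^^ 2) f 1 - (deriv01 ^^ 2) f 0)"
proof -
  have "(\<lambda>n. real n ^ 3 * remainder (radau_sum n) (\<lambda>x. f (1 - x)))
      \<longlonglongrightarrow> - (sqrt 3 / 216) * ((deriv01 ^^ 2) f (1 - 1) - (deriv01 ^^ 2) f (1 - 0))"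
    by (rule remainder_radau_sum_limit[OF C_class_3_reflect[OF assms]])
  then have "(\<lambda>n. real n ^ 3 * remainder (radau_sum n) (\<lambda>x. f (1 - x)))
      \<longlonglongrightarrow> sqrt 3 / 216 * ((deriv01 ^^ 2) f 1 - (deriv01 ^^ 2) f 0)"
    by (simp add: algebra_simps)
  then show ?thesis
    unfolding remainder_radau_left[OF C2_derivs_continuous(1)[OF C_class_3_derivs(1)[OF assms]]]
    by (rule Lim_transform_eventually)
      (use radau_right_eq(1) in \<open>auto intro!: eventually_mono[OF eventually_gt_at_top[of 0]]\<close>)
qed

section \<open>Order and eventual sign of the remainder\<close>

lemma smallo_inverse_cube_iff:
  fixes r :: "nat \<Rightarrow> real"
  assumes "(\<lambda>n. real n ^ 3 * r n) \<longlonglongrightarrow> l"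
  shows "r \<in> o(\<lambda>n. 1 / real n ^ 3) \<longleftrightarrow> l = 0"
proof
  \<comment> \<open>True even at n = 0, where division by zero makes both sides 0.\<close>
  have eq: "(\<lambda>n. r n / (1 / real n ^ 3)) = (\<lambda>n. real n ^ 3 * r n)"
    by (simp add: mult.commute)
  {
    assume "r \<in> o(\<lambda>n. 1 / real n ^ 3)"
    then have "(\<lambda>n. real n ^ 3 * r n) \<longlonglongrightarrow> 0"
      using smalloD_tendsto unfolding eq[symmetric] by blast
    then show "l = 0"
      using assms LIMSEQ_unique by blast
  }
  assume "l = 0"
  show "r \<in> o(\<lambda>n. 1 / real n ^ 3)"
  proof (rule smalloI_tendsto)
    show "(\<lambda>n. r n / (1 / real n ^ 3)) \<longlonglongrightarrow> 0"
      unfolding eq using assms \<open>l = 0\<close> by simp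
    show "\<forall>\<^sub>F n in sequentially. 1 / real n ^ 3 \<noteq> 0"
      using eventually_gt_at_top[of 0] by eventually_elim simp
  qed
qed

lemma eventually_sign_of_limit:
  fixes r :: "nat \<Rightarrow> real"
  assumes "(\<lambda>n. real n ^ 3 * r n) \<longlonglongrightarrow> l" "0 < e * l"
  shows "\<forall>\<^sub>F n in sequentially. 0 \<le> e * r n"
proof -
  have "(\<lambda>n. e * (real n ^ 3 * r n)) \<longlonglongrightarrow> e * l"
    using assms(1) by (rule tendsto_mult_left)
  then have "\<forall>\<^sub>F n in sequentially. 0 < e * (real n ^ 3 * r n)"
    using assms(2) by (rule order_tendstoD(1))
  then show ?thesis
    using eventually_gt_at_top[of 0]
  proof eventually_elim
    case (elim n)
    then have "0 < real n ^ 3 * (e * r n)" "0 < real n ^ 3"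
      by (simp_all only: mult_ac) simp
    then show ?case
      using zero_less_mult_pos less_imp_le by blast
  qed
qed

text \<open>The place where absolute continuity is used. From here on (c) concerns C^2 functions
  with nondecreasing second derivative.\<close>

lemma sobolev_deriv2_mono:
  assumes f: "f \<in> sobolev_1_3" "third_deriv_nonneg_ae f" and xy: "0 \<le> x" "x \<le> y" "y \<le> 1"
  shows "(deriv01 ^^ 2) f x \<le> (deriv01 ^^ 2) f y"
proof -
  let ?P = "\<lambda>t. (deriv01 ^^ 2) f differentiable (at t within {0..1}) \<and> (deriv01 ^^ 3) f t \<ge> 0"
  have "AE t in lebesgue. t \<in> {0..1} \<longrightarrow> ?P t"
    using f(2) unfolding third_deriv_nonneg_ae_def by (subst (asm) AE_restrict_space_iff) auto
  then obtain N where N: "negligible N" "{t. \<not> (t \<in> {0..1} \<longrightarrow> ?P t)} \<subseteq> N"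
    unfolding eventually_ae_filter_negligible by blast
  have P: "?P t" if "t \<in> {x..y} - N" for t
  proof -
    have "t \<in> {0..1}"
      using that xy by auto
    then show ?thesis
      using N(2) that by blast
  qed
  show ?thesis
  proof (rule abs_continuous_on_nondecreasing[OF _ \<open>x \<le> y\<close> _ N(1)])
    show "abs_continuous_on {0..1} ((deriv01 ^^ 2) f)"
      using f(1) by (simp add: sobolev_1_3_def)
    show "((deriv01 ^^ 2) f has_real_derivative (deriv01 ^^ 3) f t) (at t within {0..1})"
      if "t \<in> {x..y} - N" for t
      using deriv01_works[of "(deriv01 ^^ 2) f" t] P[OF that] by (simp add: numeral_3_eq_3 numeral_2_eq_2)
    show "0 \<le> (deriv01 ^^ 3) f t" if "t \<in> {x..y} - N" for t
      using P[OF that] by simp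
  qed (use xy in auto)
qed

lemma C2_derivs_neg:
  assumes "C2_derivs g g1 g2"
  shows "C2_derivs (\<lambda>x. - g x) (\<lambda>x. - g1 x) (\<lambda>x. - g2 x)"
  using assms unfolding C2_derivs_def by (auto intro!: derivative_eq_intros continuous_intros)

lemma remainder_radau_sum_neg: "remainder (radau_sum n) (\<lambda>x. - f x) = - remainder (radau_sum n) f"
  by (simp add: remainder_def radau_sum_def sum_negf)

lemma radau_remainders_mono:
  assumes "0 < n" and f: "f \<in> C_class 2"
    and mono: "\<And>x y. \<lbrakk>0 \<le> x; x \<le> y; y \<le> 1\<rbrakk> \<Longrightarrow> (deriv01 ^^ 2) f x \<le> (deriv01 ^^ 2) f y"
  shows "remainder (radau_right n) f \<le> 0" "remainder (radau_right n) f \<le> remainder (radau_right (2 * n)) f"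
    "0 \<le> remainder (radau_left n) f" "remainder (radau_left (2 * n)) f \<le> remainder (radau_left n) f"
proof -
  note d = C_class_2_derivs[OF f]
  have "0 < 2 * n"
    using assms(1) by simp
  note right = radau_right_eq(1)[OF assms(1)] radau_right_eq(1)[OF \<open>0 < 2 * n\<close>]
  show "remainder (radau_right n) f \<le> 0" "remainder (radau_right n) f \<le> remainder (radau_right (2 * n)) f"
    unfolding right
    by (rule remainder_radau_sum_nonpos[OF assms(1) d mono], assumption+)
      (rule remainder_radau_sum_double[OF assms(1) d mono])
  \<comment> \<open>Reflection makes the second derivative nonincreasing; the extra minus sign
    restores monotonicity and reverses the resulting inequalities.\<close>
  note reflected = C2_derivs_neg[OF C2_derivs_reflect[OF d]]
  have mono': "- (deriv01 ^^ 2) f (1 - x) \<le> - (deriv01 ^^ 2) f (1 - y)" if "0 \<le> x" "x \<le> y" "y \<le> 1" for x y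
    using mono[of "1 - y" "1 - x"] that by simp
  have left: "remainder (radau_left m) f = - remainder (radau_sum m) (\<lambda>x. - f (1 - x))" if "0 < m" for m
    unfolding remainder_radau_left[OF C2_derivs_continuous(1)[OF d]] radau_right_eq(1)[OF that] remainder_radau_sum_neg
    by simp
  show "0 \<le> remainder (radau_left n) f"
    using remainder_radau_sum_nonpos[OF assms(1) reflected mono'] unfolding left[OF assms(1)] by simp
  show "remainder (radau_left (2 * n)) f \<le> remainder (radau_left n) f"
    using remainder_radau_sum_double[OF assms(1) reflected mono']
    unfolding left[OF assms(1)] left[OF \<open>0 < 2 * n\<close>] by simp
qed

lemma radau_eventually_signed:
  assumes f: "f \<in> C_class 3" and \<epsilon>: "\<epsilon> = sgn ((deriv01 ^^ 2) f 1 - (deriv01 ^^ 2) f 0)" "\<epsilon> \<noteq> 0"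
  shows "\<exists>n\<^sub>0. \<forall>n\<ge>n\<^sub>0. \<epsilon> * remainder (radau_right n) f \<le> 0 \<and> \<epsilon> * remainder (radau_left n) f \<ge> 0"
proof -
  let ?D = "(deriv01 ^^ 2) f 1 - (deriv01 ^^ 2) f 0"
  have "0 < \<epsilon> * ?D"
    using \<epsilon> by (auto simp: sgn_if split: if_splits)
  then have "0 < \<epsilon> * (sqrt 3 / 216 * ?D)" "0 < (- \<epsilon>) * (- (sqrt 3 / 216) * ?D)"
    using mult_pos_pos[of "sqrt 3 / 216" "\<epsilon> * ?D"] by (simp_all add: mult_ac)
  from eventually_sign_of_limit[OF remainder_radau_left_limit[OF f] this(1)]
    eventually_sign_of_limit[OF remainder_radau_right_limit[OF f] this(2)]
  have "\<forall>\<^sub>F n in sequentially. \<epsilon> * remainder (radau_right n) f \<le> 0 \<and> \<epsilon> * remainder (radau_left n) f \<ge> 0"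
    by eventually_elim simp
  then show ?thesis
    by (simp add: eventually_sequentially)
qed

lemma radau_error_constants:
  assumes "0 < n"
  shows "error_constant 3 (radau_right n) = - radau_const n" "error_constant 3 (radau_left n) = radau_const n"
  by (fact error_constant_eqI[OF error_constant_radau_right[OF assms]]
      error_constant_eqI[OF error_constant_radau_left[OF assms]])+

theorem theorem1:
  shows
    "(\<forall>n\<ge>2. \<exists>!Q. is_right_radau n Q) \<and>
     \<comment> \<open>(a)\<close>
     (\<forall>n\<ge>2.
        definite 3 (radau_left n) \<and> definite 3 (radau_right n) \<and>
        error_constant 3 (radau_left n) = - error_constant 3 (radau_right n) \<and>
        - error_constant 3 (radau_right n) =
          sqrt 3 / (216 * real n ^ 3) -
          sqrt 3 / (108 * real n ^ 4) * (\<Sum>k=0..n-1. 1 / ((2 + sqrt 3) ^ (2 * k + 1) + 1))) \<and>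
     (\<forall>Q\<in>{radau_right, radau_left}. \<forall>n\<ge>4.
        sqrt 3 / (216 * real n ^ 3) - 1 / (269.13 * real n ^ 4) < \<bar>error_constant 3 (Q n)\<bar> \<and>
        \<bar>error_constant 3 (Q n)\<bar> < sqrt 3 / (216 * real n ^ 3) - 1 / (269.14 * real n ^ 4)) \<and>
     \<comment> \<open>(b)\<close>
     (\<forall>f\<in>C_class 3.
        (\<forall>Q\<in>{radau_right, radau_left}.
           (\<lambda>n. remainder (Q n) f) \<in> o(\<lambda>n. 1 / real n ^ 3) \<longleftrightarrow>
           (deriv01 ^^ 2) f 0 = (deriv01 ^^ 2) f 1) \<and>
        (\<forall>\<epsilon>. \<epsilon> = sgn ((deriv01 ^^ 2) f 1 - (deriv01 ^^ 2) f 0) \<longrightarrow> \<epsilon> \<noteq> 0 \<longrightarrow>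
           (\<exists>n\<^sub>0. \<forall>n\<ge>n\<^sub>0.
              \<epsilon> * remainder (radau_right n) f \<le> 0 \<and> \<epsilon> * remainder (radau_left n) f \<ge> 0))) \<and>
     \<comment> \<open>(c)\<close>
     (\<forall>f\<in>sobolev_1_3. third_deriv_nonneg_ae f \<longrightarrow>
        (\<forall>n\<ge>2.
           0 \<ge> remainder (radau_right (2 * n)) f \<and>
           remainder (radau_right (2 * n)) f \<ge> remainder (radau_right n) f \<and>
           0 \<le> remainder (radau_left (2 * n)) f \<and>
           remainder (radau_left (2 * n)) f \<le> remainder (radau_left n) f))"
proof (intro conjI)
  show "\<forall>n\<ge>2. \<exists>!Q. is_right_radau n Q"
    using radau_right_eq(2) by simp
  show "\<forall>n\<ge>2.
        definite 3 (radau_left n) \<and> definite 3 (radau_right n) \<and>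
        error_constant 3 (radau_left n) = - error_constant 3 (radau_right n) \<and>
        - error_constant 3 (radau_right n) =
          sqrt 3 / (216 * real n ^ 3) -
          sqrt 3 / (108 * real n ^ 4) * (\<Sum>k=0..n-1. 1 / ((2 + sqrt 3) ^ (2 * k + 1) + 1))"
  proof (intro allI impI)
    fix n :: nat assume "2 \<le> n"
    \<comment> \<open>For n = 0 the ranges would differ, since truncated subtraction makes {0..n -
      1} the set {0}.\<close>
    then have n: "0 < n" and range: "{0..n - 1} = {..<n}"
      by auto
    show "definite 3 (radau_left n) \<and> definite 3 (radau_right n) \<and>
        error_constant 3 (radau_left n) = - error_constant 3 (radau_right n) \<and>
        - error_constant 3 (radau_right n) =
          sqrt 3 / (216 * real n ^ 3) -
          sqrt 3 / (108 * real n ^ 4) * (\<Sum>k=0..n-1. 1 / ((2 + sqrt 3) ^ (2 * k + 1) + 1))"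
      unfolding definite_def radau_error_constants[OF n] range minus_minus
      using error_constant_radau_right[OF n] error_constant_radau_left[OF n] radau_const_closed_form[of n]
      by blast
  qed
  show "\<forall>Q\<in>{radau_right, radau_left}. \<forall>n\<ge>4.
        sqrt 3 / (216 * real n ^ 3) - 1 / (269.13 * real n ^ 4) < \<bar>error_constant 3 (Q n)\<bar> \<and>
        \<bar>error_constant 3 (Q n)\<bar> < sqrt 3 / (216 * real n ^ 3) - 1 / (269.14 * real n ^ 4)"
  proof (intro ballI allI impI)
    fix Q and n :: nat assume Q: "Q \<in> {radau_right, radau_left}" and "4 \<le> n"
    then have n: "0 < n"
      by simp
    have abs: "\<bar>error_constant 3 (Q n)\<bar> = radau_const n"
      using Q radau_error_constants[OF n] radau_const_pos[OF n] by auto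
    show "sqrt 3 / (216 * real n ^ 3) - 1 / (269.13 * real n ^ 4) < \<bar>error_constant 3 (Q n)\<bar> \<and>
        \<bar>error_constant 3 (Q n)\<bar> < sqrt 3 / (216 * real n ^ 3) - 1 / (269.14 * real n ^ 4)"
      unfolding abs using radau_const_bounds[OF \<open>4 \<le> n\<close>] by blast
  qed
  show "\<forall>f\<in>C_class 3.
        (\<forall>Q\<in>{radau_right, radau_left}.
           (\<lambda>n. remainder (Q n) f) \<in> o(\<lambda>n. 1 / real n ^ 3) \<longleftrightarrow>
           (deriv01 ^^ 2) f 0 = (deriv01 ^^ 2) f 1) \<and>
        (\<forall>\<epsilon>. \<epsilon> = sgn ((deriv01 ^^ 2) f 1 - (deriv01 ^^ 2) f 0) \<longrightarrow> \<epsilon> \<noteq> 0 \<longrightarrow>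
           (\<exists>n\<^sub>0. \<forall>n\<ge>n\<^sub>0.
              \<epsilon> * remainder (radau_right n) f \<le> 0 \<and> \<epsilon> * remainder (radau_left n) f \<ge> 0))"
  proof (intro ballI conjI allI impI)
    fix f Q assume f: "f \<in> C_class 3" and "Q \<in> {radau_right, radau_left}"
    then show "(\<lambda>n. remainder (Q n) f) \<in> o(\<lambda>n. 1 / real n ^ 3) \<longleftrightarrow>
        (deriv01 ^^ 2) f 0 = (deriv01 ^^ 2) f 1"
      using smallo_inverse_cube_iff[OF remainder_radau_right_limit[OF f]]
        smallo_inverse_cube_iff[OF remainder_radau_left_limit[OF f]]
      by auto
  next
    fix f \<epsilon> assume "f \<in> C_class 3" "\<epsilon> = sgn ((deriv01 ^^ 2) f 1 - (deriv01 ^^ 2) f 0)" "\<epsilon> \<noteq> 0"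
    then show "\<exists>n\<^sub>0. \<forall>n\<ge>n\<^sub>0. \<epsilon> * remainder (radau_right n) f \<le> 0 \<and> \<epsilon> * remainder (radau_left n) f \<ge> 0"
      by (rule radau_eventually_signed)
  qed
  show "\<forall>f\<in>sobolev_1_3. third_deriv_nonneg_ae f \<longrightarrow>
        (\<forall>n\<ge>2.
           0 \<ge> remainder (radau_right (2 * n)) f \<and>
           remainder (radau_right (2 * n)) f \<ge> remainder (radau_right n) f \<and>
           0 \<le> remainder (radau_left (2 * n)) f \<and>
           remainder (radau_left (2 * n)) f \<le> remainder (radau_left n) f)"
  proof (intro ballI allI impI)
    fix f and n :: nat assume f: "f \<in> sobolev_1_3" "third_deriv_nonneg_ae f" and "2 \<le> n"
    then have C2: "f \<in> C_class 2" and n: "0 < n" "0 < 2 * n"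
      by (auto simp: sobolev_1_3_def)
    note mono = sobolev_deriv2_mono[OF f]
    \<comment> \<open>The signs are claimed at 2n and come from the instance for 2n; the comparisons
      come from the instance for n.\<close>
    show "0 \<ge> remainder (radau_right (2 * n)) f \<and>
           remainder (radau_right (2 * n)) f \<ge> remainder (radau_right n) f \<and>
           0 \<le> remainder (radau_left (2 * n)) f \<and>
           remainder (radau_left (2 * n)) f \<le> remainder (radau_left n) f"
      using radau_remainders_mono[OF n(1) C2 mono] radau_remainders_mono[OF n(2) C2 mono] by blast
  qed
qed

end
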